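(* Let $\mathcal V$ be a Poisson vertex algebra with $\lambda$-bracket $\{\cdot_\lambda\cdot\}$. Then the space of Kähler differentials $\Omega(\mathcal V)$ has a natural structure of a Lie conformal algebroid over $\mathcal V$, with the left $\mathcal V[\partial]$-module structure given by $\partial(f\,dg)=(\partial f)dg+f\,d(\partial g)$; with the anchor map $\theta:\Omega(\mathcal V)\to\mathrm{CDer}(\mathcal V)$ defined on generators by $$\theta(df)_\lambda(g)=\{f_\lambda g\}\qquad (f,g\in\mathcal V)$$ and uniquely extended to a left $\mathcal V[\partial]$-module homomorphism; and with the $\lambda$-bracket $[\cdot_\lambda\cdot]:\Omega(\mathcal V)^{\otimes2}\to\Omega(\mathcal V)[\lambda]$ defined on generators by $$[df_\lambda dg]=d\big(\{f_\lambda g\}\big)\qquad(f,g\in\mathcal V)$$ and uniquely extended to a $\lambda$-bracket on $\Omega(\mathcal V)$ satisfying, for all $u,v\in\Omega(\mathcal V)$ and $a(\partial)\in\mathcal V[\partial]$, (i) $[u_\lambda a(\partial)v]=a(\lambda+x)\big(\big|_{x=\partial}[u_\lambda v]\big)+\theta(u)_\lambda(a(x))\big(\big|_{x=\partial}v\big)$, and (i') $[a(\partial)u_\lambda v]=\big(\big|_{x=\partial}a^*(\lambda)\big)[u_{\lambda+x}v]-\theta(v)^*_{\lambda+x}(a(x))\big(\big|_{x=\partial}u\big)$.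
   Context: Everything is over a field $\mathbb F$ of characteristic $0$. A differential algebra $A$ is a commutative associative unital algebra with a derivation $\partial$; $A[\partial]$ is the associative algebra of differential operators $a(\partial)=\sum_i a_i\partial^i$ (product = composition), with symbol $a(x)=\sum_ia_ix^i$ and adjoint symbol $a^*(\lambda)=\sum_i(-\lambda-\partial)^i(a_i)\in A[\lambda]$. Substitution convention: in an expression containing a factor $\big(\big|_{x=\partial}f\big)$, expand the whole expression in powers of the commuting indeterminate $x$ and replace each $x^n$ by $\partial^n$ acting only on what is inside that parenthesis (on coefficients, if $f$ is a polynomial). E.g. $a(\lambda+x)\big(\big|_{x=\partial}b\big)c=c\sum_ia_i(\lambda+\partial)^i(b)$. For $\phi_\lambda$ linear, $\phi_\lambda(a(x))=\sum_i\phi_\lambda(a_i)x^i$, and similarly $\phi_{\lambda+x}(a(x))=\sum_i\phi_{\lambda+x}(a_i)x^i$. $\mathrm{CDer}(A)$ is the space of linear maps $\phi_\lambda:A\to A[\lambda]$ with $\phi_\lambda(\partial a)=(\partial+\lambda)\phi_\lambda(a)$ and $\phi_\lambda(ab)=\phi_\lambda(a)b+a\phi_\lambda(b)$; it is a left $A[\partial]$-module by $(a(\partial)\phi)_\lambda=\big(\big|_{x=\partial}a^*(\lambda)\big)\phi_{\lambda+x}$. For $\phi\in\mathrm{CDer}(A)$ put $\phi^*_\lambda(a)=\big(\big|_{x=\partial}\phi_{-\lambda-x}(a)\big)$. A Lie conformal algebra (LCA) is an $\mathbb F[\partial]$-module $E$ with a bilinear $\lambda$-bracket $[\cdot_\lambda\cdot]:E\otimes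 E\to E[\lambda]$ with: $[\partial u_\lambda v]=-\lambda[u_\lambda v]$, $[u_\lambda\partial v]=(\partial+\lambda)[u_\lambda v]$; $[v_\lambda u]=-\big(\big|_{x=\partial}[u_{-\lambda-x}v]\big)$; $[u_\lambda[v_\mu w]]-[v_\mu[u_\lambda w]]=[[u_\lambda v]_{\lambda+\mu}w]$. A Lie conformal algebroid (LCAd) over $A$ is a left $A[\partial]$-module $E$ with a left $A[\partial]$-module homomorphism $\theta:E\to\mathrm{CDer}(A)$ (anchor) and an LCA $\lambda$-bracket such that (i) $[u_\lambda a(\partial)v]=a(\lambda+x)\big(\big|_{x=\partial}[u_\lambda v]\big)+\theta(u)_\lambda(a(x))\big(\big|_{x=\partial}v\big)$, and (ii) $\theta([u_\lambda v])_\mu(a)=\theta(u)_\lambda(\theta(v)_{\mu-\lambda}(a))-\theta(v)_{\mu-\lambda}(\theta(u)_\lambda(a))$. A Poisson vertex algebra (PVA) is a differential algebra $\mathcal V$ with an LCA $\lambda$-bracket $\{\cdot_\lambda\cdot\}$ on the $\mathbb F[\partial]$-module $\mathcal V$ satisfying the Leibniz rule $\{f_\lambda gh\}=g\{f_\lambda h\}+h\{f_\lambda g\}$. $\Omega(\mathcal V)$ is the $\mathcal V$-module generated by symbols $df$, $f\in\mathcal V$, modulo linearity of $d$ and $d(fg)=f\,dg+g\,df$. The map $d:\mathcal V\to\Omega(\mathcal V)$ is extended to $\mathcal V[\lambda]\to\Omega(\mathcal V)[\lambda]$ coefficientwise. *)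

theory Defs
  imports
    Complex_Main
    "HOL-Computational_Algebra.Polynomial"
    "HOL-Library.Poly_Mapping"
begin

text \<open>
  Polynomials \<open>E[\<lambda>]\<close> with coefficients in an additive group \<open>E\<close> are elements of the type
  \<open>'e poly\<close>. Elements of \<open>E[\<lambda>,\<mu>]\<close> are elements of \<open>'e poly poly\<close>, read as \<open>(E[\<lambda>])[\<mu>]\<close>:
  the outer variable is \<open>\<mu>\<close> and the inner variable is \<open>\<lambda>\<close>. Thus multiplication by \<open>\<mu>\<close> is
  \<open>pCons 0\<close> and multiplication by \<open>\<lambda>\<close> is \<open>map_poly (pCons 0)\<close>; if \<open>p\<close> is a polynomial in \<open>\<mu>\<close>
  with coefficients in \<open>E\<close>, then \<open>\<lambda>\<^sup>k p\<close> is \<open>map_poly (\<lambda>e. monom e k) p\<close>.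
\<close>

text \<open>
  The operator \<open>\<lambda> + D\<close> on \<open>E[\<lambda>]\<close>, with \<open>D\<close> acting on coefficients.
\<close>

definition var_plus :: "('e::ab_group_add \<Rightarrow> 'e) \<Rightarrow> 'e poly \<Rightarrow> 'e poly" where
  "var_plus D p = pCons 0 p + map_poly D p"

text \<open>
  \<open>subst_var T p\<close> substitutes the operator \<open>T\<close> for the variable of \<open>p\<close>: it is
  \<open>\<Sum>\<^sub>i T\<^sup>i(p\<^sub>i)\<close>, each coefficient \<open>p\<^sub>i\<close> being regarded as a constant polynomial. With
  \<open>T = -\<lambda>-\<partial>\<close> this is \<open>(|\<^sub>x\<^sub>=\<^sub>\<partial> p(-\<lambda>-x))\<close>, because \<open>\<lambda>\<close> and \<open>\<partial>\<close> commute.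
\<close>

definition subst_var ::
    "('e::ab_group_add poly \<Rightarrow> 'e poly) \<Rightarrow> 'e poly \<Rightarrow> 'e poly" where
  "subst_var T p = (\<Sum>i\<le>degree p. (T ^^ i) [:coeff p i:])"

abbreviation neg_var_minus :: "('e::ab_group_add \<Rightarrow> 'e) \<Rightarrow> 'e poly \<Rightarrow> 'e poly" where
  "neg_var_minus D \<equiv> (\<lambda>p. - var_plus D p)"

definition lam_plus_mu :: "'e::ab_group_add poly poly \<Rightarrow> 'e poly poly" where
  "lam_plus_mu q = map_poly (pCons 0) q + pCons 0 q"

definition mu_minus_lam :: "'e::ab_group_add poly poly \<Rightarrow> 'e poly poly" where
  "mu_minus_lam q = pCons 0 q - map_poly (pCons 0) q"


section \<open>Differential algebras and differential operators\<close>

locale differential_algebra = vector_space scale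
  for scale :: "'k::field_char_0 \<Rightarrow> 'a::comm_ring_1 \<Rightarrow> 'a" +
  fixes der :: "'a \<Rightarrow> 'a"
  assumes scale_mult_left: "scale c (a * b) = scale c a * b"
    and der_linear: "Vector_Spaces.linear scale scale der"
    and der_mult: "der (a * b) = der a * b + a * der b"

text \<open>
  A differential operator \<open>a(\<partial>) = \<Sum>\<^sub>i a\<^sub>i \<partial>\<^sup>i\<close> is represented by its symbol \<open>a(x)\<close>. The product
  of \<open>A[\<partial>]\<close> is determined by \<open>\<partial> b(\<partial>) = b(\<partial>) \<partial> + b'(\<partial>)\<close> with \<open>b'\<close> obtained from \<open>b\<close> by
  applying the derivation to the coefficients; that is, left multiplication by \<open>\<partial>\<close> acts on
  symbols as \<open>x + \<partial>\<close>.
\<close>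

definition dop_mult :: "('a::comm_ring_1 \<Rightarrow> 'a) \<Rightarrow> 'a poly \<Rightarrow> 'a poly \<Rightarrow> 'a poly" where
  "dop_mult der a b = (\<Sum>i\<le>degree a. smult (coeff a i) ((var_plus der ^^ i) b))"

text \<open>The adjoint symbol \<open>a\<^sup>*(\<lambda>) = \<Sum>\<^sub>i (-\<lambda>-\<partial>)\<^sup>i(a\<^sub>i)\<close>.\<close>

definition adj_symbol :: "('a::comm_ring_1 \<Rightarrow> 'a) \<Rightarrow> 'a poly \<Rightarrow> 'a poly" where
  "adj_symbol der a = subst_var (neg_var_minus der) a"

text \<open>
  Left \<open>A[\<partial>]\<close>-modules: \<open>act a u\<close> is \<open>a(\<partial>)u\<close>. In particular \<open>act [:f:] u\<close> is \<open>fu\<close> for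
  \<open>f \<in> A\<close>, \<open>act [:0, 1:] u\<close> is \<open>\<partial>u\<close>, and \<open>act [:scale c 1:] u\<close> is the action of a scalar.
\<close>

definition left_dop_module ::
    "('a::comm_ring_1 \<Rightarrow> 'a) \<Rightarrow> ('a poly \<Rightarrow> 'e::ab_group_add \<Rightarrow> 'e) \<Rightarrow> bool" where
  "left_dop_module der act \<longleftrightarrow>
    (\<forall>a u v. act a (u + v) = act a u + act a v) \<and>
    (\<forall>a b u. act (a + b) u = act a u + act b u) \<and>
    (\<forall>a b u. act (dop_mult der a b) u = act a (act b u)) \<and>
    (\<forall>u. act 1 u = u)"

abbreviation poly_times_vec ::
    "('a::comm_ring_1 poly \<Rightarrow> 'e::ab_group_add \<Rightarrow> 'e) \<Rightarrow> 'a poly \<Rightarrow> 'e \<Rightarrow> 'e poly" where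
  "poly_times_vec act p u \<equiv> map_poly (\<lambda>c. act [:c:] u) p"

abbreviation const_times_poly ::
    "('a::comm_ring_1 poly \<Rightarrow> 'e::ab_group_add \<Rightarrow> 'e) \<Rightarrow> 'a \<Rightarrow> 'e poly \<Rightarrow> 'e poly" where
  "const_times_poly act c q \<equiv> map_poly (act [:c:]) q"


section \<open>Conformal derivations\<close>

text \<open>A conformal derivation sends \<open>b\<close> to the polynomial \<open>\<phi>\<^sub>\<lambda>(b)\<close>.\<close>

definition CDer ::
    "('k::field_char_0 \<Rightarrow> 'a::comm_ring_1 \<Rightarrow> 'a) \<Rightarrow> ('a \<Rightarrow> 'a) \<Rightarrow> ('a \<Rightarrow> 'a poly) set" where
  "CDer scale der = {\<phi>.
     Vector_Spaces.linear scale (\<lambda>c. map_poly (scale c)) \<phi> \<and>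
     (\<forall>a. \<phi> (der a) = var_plus der (\<phi> a)) \<and>
     (\<forall>a b. \<phi> (a * b) = smult b (\<phi> a) + smult a (\<phi> b))}"

text \<open>
  \<open>(a(\<partial>)\<phi>)\<^sub>\<lambda>(b) = (|\<^sub>x\<^sub>=\<^sub>\<partial> a\<^sup>*(\<lambda>)) \<phi>\<^sub>\<lambda>\<^sub>+\<^sub>x(b)\<close>. Writing \<open>\<phi>\<^sub>\<lambda>(b) = \<Sum>\<^sub>n \<lambda>\<^sup>n b\<^sub>n\<close>, expanding
  \<open>(\<lambda>+x)\<^sup>n\<close> and replacing \<open>x\<close> by \<open>\<partial>\<close> acting on \<open>a\<^sup>*(\<lambda>)\<close> gives
  \<open>\<Sum>\<^sub>n b\<^sub>n (\<lambda>+\<partial>)\<^sup>n(a\<^sup>*(\<lambda>))\<close>. Substitutions of \<open>\<lambda>+x\<close> below are expanded in the same way.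
\<close>

definition cder_act ::
    "('a::comm_ring_1 \<Rightarrow> 'a) \<Rightarrow> 'a poly \<Rightarrow> ('a \<Rightarrow> 'a poly) \<Rightarrow> 'a \<Rightarrow> 'a poly" where
  "cder_act der a \<phi> b =
    (\<Sum>n\<le>degree (\<phi> b). smult (coeff (\<phi> b) n) ((var_plus der ^^ n) (adj_symbol der a)))"

text \<open>\<open>\<phi>\<^sup>*\<^sub>\<lambda>(a) = (|\<^sub>x\<^sub>=\<^sub>\<partial> \<phi>\<^sub>-\<^sub>\<lambda>\<^sub>-\<^sub>x(a))\<close>.\<close>

definition cder_adj :: "('a::comm_ring_1 \<Rightarrow> 'a) \<Rightarrow> ('a \<Rightarrow> 'a poly) \<Rightarrow> 'a \<Rightarrow> 'a poly" where
  "cder_adj der \<phi> a = subst_var (neg_var_minus der) (\<phi> a)"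


section \<open>Lie conformal algebras and Poisson vertex algebras\<close>

definition bilinear_bracket ::
    "('k::field_char_0 \<Rightarrow> 'e::ab_group_add \<Rightarrow> 'e) \<Rightarrow> ('e \<Rightarrow> 'e \<Rightarrow> 'e poly) \<Rightarrow> bool" where
  "bilinear_bracket scale br \<longleftrightarrow>
    (\<forall>u. Vector_Spaces.linear scale (\<lambda>c. map_poly (scale c)) (br u)) \<and>
    (\<forall>v. Vector_Spaces.linear scale (\<lambda>c. map_poly (scale c)) (\<lambda>u. br u v))"

text \<open>
  \<open>br u v\<close> is \<open>[u\<^sub>\<lambda> v] \<in> E[\<lambda>]\<close>. The three terms of the Jacobi identity in \<open>E[\<lambda>,\<mu>]\<close> are:
  \<open>[u\<^sub>\<lambda>[v\<^sub>\<mu> w]]\<close>, where \<open>[u\<^sub>\<lambda> \<cdot>]\<close> is applied to the coefficients of the polynomial \<open>[v\<^sub>\<mu> w]\<close> in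
  the outer variable; \<open>[v\<^sub>\<mu>[u\<^sub>\<lambda> w]] = \<Sum>\<^sub>m \<lambda>\<^sup>m [v\<^sub>\<mu> w\<^sub>m]\<close> for \<open>[u\<^sub>\<lambda> w] = \<Sum>\<^sub>m \<lambda>\<^sup>m w\<^sub>m\<close>; and
  \<open>[[u\<^sub>\<lambda> v]\<^sub>\<lambda>\<^sub>+\<^sub>\<mu> w] = \<Sum>\<^sub>k \<lambda>\<^sup>k [(v\<^sub>k)\<^sub>\<lambda>\<^sub>+\<^sub>\<mu> w]\<close> for \<open>[u\<^sub>\<lambda> v] = \<Sum>\<^sub>k \<lambda>\<^sup>k v\<^sub>k\<close>.
\<close>

locale lie_conformal_algebra = vector_space scale
  for scale :: "'k::field_char_0 \<Rightarrow> 'e::ab_group_add \<Rightarrow> 'e" +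
  fixes D :: "'e \<Rightarrow> 'e"
    and br :: "'e \<Rightarrow> 'e \<Rightarrow> 'e poly"
  assumes D_linear: "Vector_Spaces.linear scale scale D"
    and bilinear: "bilinear_bracket scale br"
    and sesquilinear_left: "br (D u) v = - pCons 0 (br u v)"
    and sesquilinear_right: "br u (D v) = var_plus D (br u v)"
    and skew: "br v u = - subst_var (neg_var_minus D) (br u v)"
    and jacobi:
      "map_poly (br u) (br v w)
        - (\<Sum>m\<le>degree (br u w). map_poly (\<lambda>e. monom e m) (br v (coeff (br u w) m)))
       = (\<Sum>k\<le>degree (br u v).
            subst_var lam_plus_mu (map_poly (\<lambda>e. monom e k) (br (coeff (br u v) k) w)))"

locale poisson_vertex_algebra =
  differential_algebra scale der + lie_conformal_algebra scale der pb
  for scale :: "'k::field_char_0 \<Rightarrow> 'a::comm_ring_1 \<Rightarrow> 'a"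
    and der :: "'a \<Rightarrow> 'a"
    and pb :: "'a \<Rightarrow> 'a \<Rightarrow> 'a poly" +
  assumes leibniz: "pb f (g * h) = smult g (pb f h) + smult h (pb f g)"


section \<open>Lie conformal algebroids\<close>

definition is_anchor ::
    "('k::field_char_0 \<Rightarrow> 'a::comm_ring_1 \<Rightarrow> 'a) \<Rightarrow> ('a \<Rightarrow> 'a) \<Rightarrow>
     ('a poly \<Rightarrow> 'e::ab_group_add \<Rightarrow> 'e) \<Rightarrow> ('e \<Rightarrow> 'a \<Rightarrow> 'a poly) \<Rightarrow> bool" where
  "is_anchor scale der act \<theta> \<longleftrightarrow>
    (\<forall>u. \<theta> u \<in> CDer scale der) \<and>
    (\<forall>u v b. \<theta> (u + v) b = \<theta> u b + \<theta> v b) \<and>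
    (\<forall>a u b. \<theta> (act a u) b = cder_act der a (\<theta> u) b)"

text \<open>
  \<open>[u\<^sub>\<lambda> a(\<partial>)v] = a(\<lambda>+x)(|\<^sub>x\<^sub>=\<^sub>\<partial> [u\<^sub>\<lambda> v]) + \<theta>(u)\<^sub>\<lambda>(a(x))(|\<^sub>x\<^sub>=\<^sub>\<partial> v)\<close>, which expands to
  \<open>\<Sum>\<^sub>i a\<^sub>i (\<lambda>+\<partial>)\<^sup>i [u\<^sub>\<lambda> v] + \<Sum>\<^sub>i \<theta>(u)\<^sub>\<lambda>(a\<^sub>i) \<partial>\<^sup>i v\<close>.
\<close>

definition right_rule ::
    "('a::comm_ring_1 poly \<Rightarrow> 'e::ab_group_add \<Rightarrow> 'e) \<Rightarrow> ('e \<Rightarrow> 'a \<Rightarrow> 'a poly) \<Rightarrow>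
     ('e \<Rightarrow> 'e \<Rightarrow> 'e poly) \<Rightarrow> bool" where
  "right_rule act \<theta> br \<longleftrightarrow>
    (\<forall>u v a. br u (act a v) =
       (\<Sum>i\<le>degree a. const_times_poly act (coeff a i) ((var_plus (act [:0, 1:]) ^^ i) (br u v)))
     + (\<Sum>i\<le>degree a. poly_times_vec act (\<theta> u (coeff a i)) ((act [:0, 1:] ^^ i) v)))"

text \<open>
  \<open>[a(\<partial>)u\<^sub>\<lambda> v] = (|\<^sub>x\<^sub>=\<^sub>\<partial> a\<^sup>*(\<lambda>))[u\<^sub>\<lambda>\<^sub>+\<^sub>x v] - \<theta>(v)\<^sup>*\<^sub>\<lambda>\<^sub>+\<^sub>x(a(x))(|\<^sub>x\<^sub>=\<^sub>\<partial> u)\<close>. With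
  \<open>[u\<^sub>\<lambda> v] = \<Sum>\<^sub>n \<lambda>\<^sup>n w\<^sub>n\<close> and \<open>\<theta>(v)\<^sup>*\<^sub>\<lambda>(a\<^sub>i) = \<Sum>\<^sub>n \<lambda>\<^sup>n p\<^sub>i\<^sub>n\<close> it expands to
  \<open>\<Sum>\<^sub>n (\<lambda>+\<partial>)\<^sup>n(a\<^sup>*(\<lambda>)) w\<^sub>n - \<Sum>\<^sub>i \<Sum>\<^sub>n p\<^sub>i\<^sub>n (\<lambda>+\<partial>)\<^sup>n (\<partial>\<^sup>i u)\<close>.
\<close>

definition left_rule ::
    "('a::comm_ring_1 \<Rightarrow> 'a) \<Rightarrow> ('a poly \<Rightarrow> 'e::ab_group_add \<Rightarrow> 'e) \<Rightarrow>
     ('e \<Rightarrow> 'a \<Rightarrow> 'a poly) \<Rightarrow> ('e \<Rightarrow> 'e \<Rightarrow> 'e poly) \<Rightarrow> bool" where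
  "left_rule der act \<theta> br \<longleftrightarrow>
    (\<forall>u v a. br (act a u) v =
       (\<Sum>n\<le>degree (br u v).
          poly_times_vec act ((var_plus der ^^ n) (adj_symbol der a)) (coeff (br u v) n))
     - (\<Sum>i\<le>degree a. \<Sum>n\<le>degree (cder_adj der (\<theta> v) (coeff a i)).
          const_times_poly act (coeff (cder_adj der (\<theta> v) (coeff a i)) n)
            ((var_plus (act [:0, 1:]) ^^ n) [:(act [:0, 1:] ^^ i) u:])))"

text \<open>
  In the last axiom, \<open>\<theta>([u\<^sub>\<lambda> v])\<^sub>\<mu>(a)\<close> is \<open>\<Sum>\<^sub>k \<lambda>\<^sup>k \<theta>(v\<^sub>k)\<^sub>\<mu>(a)\<close> for \<open>[u\<^sub>\<lambda> v] = \<Sum>\<^sub>k \<lambda>\<^sup>k v\<^sub>k\<close>. On the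
  other side \<open>\<theta>(u)\<^sub>\<lambda>\<close> is applied to the coefficients of \<open>\<theta>(v)\<^sub>\<nu>(a)\<close>, and \<open>\<theta>(v)\<^sub>\<nu>\<close> to those of
  \<open>\<theta>(u)\<^sub>\<lambda>(a)\<close>, before \<open>\<mu>-\<lambda>\<close> is substituted for \<open>\<nu>\<close>.
\<close>

locale lie_conformal_algebroid = differential_algebra scale der
  for scale :: "'k::field_char_0 \<Rightarrow> 'a::comm_ring_1 \<Rightarrow> 'a"
    and der :: "'a \<Rightarrow> 'a" +
  fixes act :: "'a poly \<Rightarrow> 'e::ab_group_add \<Rightarrow> 'e"
    and \<theta> :: "'e \<Rightarrow> 'a \<Rightarrow> 'a poly"
    and br :: "'e \<Rightarrow> 'e \<Rightarrow> 'e poly"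
  assumes left_module: "left_dop_module der act"
    and anchor: "is_anchor scale der act \<theta>"
    and lca: "lie_conformal_algebra (\<lambda>c. act [:scale c 1:]) (act [:0, 1:]) br"
    and right_rule: "right_rule act \<theta> br"
    and anchor_bracket:
      "(\<Sum>k\<le>degree (br u v). map_poly (\<lambda>e. monom e k) (\<theta> (coeff (br u v) k) a))
       = subst_var mu_minus_lam (map_poly (\<theta> u) (\<theta> v a))
         - (\<Sum>m\<le>degree (\<theta> u a).
              subst_var mu_minus_lam
                (map_poly (\<lambda>e. monom e m) (\<theta> v (coeff (\<theta> u a) m))))"


section \<open>Kaehler differentials\<close>

text \<open>
  The free \<open>A\<close>-module on symbols indexed by \<open>f \<in> A\<close> is \<open>'a \<Rightarrow>\<^sub>0 'a\<close>: the element
  \<open>Poly_Mapping.single f g\<close> is \<open>g\<close> times the symbol of \<open>f\<close>. (The ring structure on this type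
  is not used.)
\<close>

abbreviation free_smul :: "'a::comm_ring_1 \<Rightarrow> ('a \<Rightarrow>\<^sub>0 'a) \<Rightarrow> ('a \<Rightarrow>\<^sub>0 'a)" where
  "free_smul a \<equiv> Poly_Mapping.map ((*) a)"

definition kaehler_relations ::
    "('k::field_char_0 \<Rightarrow> 'a::comm_ring_1 \<Rightarrow> 'a) \<Rightarrow> ('a \<Rightarrow>\<^sub>0 'a) set" where
  "kaehler_relations scale =
     {Poly_Mapping.single (f + g) 1 - Poly_Mapping.single f 1 - Poly_Mapping.single g 1 | f g. True}
   \<union> {Poly_Mapping.single (scale c f) 1 - Poly_Mapping.single f (scale c 1) | c f. True}
   \<union> {Poly_Mapping.single (f * g) 1 - Poly_Mapping.single g f - Poly_Mapping.single f g | f g. True}"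

text \<open>
  \<open>\<Omega>\<close> is the \<open>A\<close>-module generated by the symbols \<open>df\<close> modulo these relations: the canonical
  map from the free module, sending the symbol of \<open>f\<close> to \<open>d f\<close>, is onto, and its kernel is the
  submodule generated by the relations. The quotient depends on \<open>scale\<close>, so it is not available
  as a type constructor; the locale describes any type carrying a copy of it.
\<close>

locale kaehler_differentials = module smul
  for scale :: "'k::field_char_0 \<Rightarrow> 'a::comm_ring_1 \<Rightarrow> 'a"
    and smul :: "'a \<Rightarrow> 'o::ab_group_add \<Rightarrow> 'o" +
  fixes d :: "'a \<Rightarrow> 'o"
  assumes generated:
      "surj (\<lambda>m. \<Sum>f\<in>Poly_Mapping.keys m. smul (Poly_Mapping.lookup m f) (d f))"
    and presented:
      "(\<Sum>f\<in>Poly_Mapping.keys m. smul (Poly_Mapping.lookup m f) (d f)) = 0 \<longleftrightarrow>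
       m \<in> module.span free_smul (kaehler_relations scale)"

definition kaehler_action ::
    "('a::comm_ring_1 \<Rightarrow> 'a) \<Rightarrow> ('a \<Rightarrow> 'o::ab_group_add \<Rightarrow> 'o) \<Rightarrow> ('a \<Rightarrow> 'o) \<Rightarrow>
     ('a poly \<Rightarrow> 'o \<Rightarrow> 'o) \<Rightarrow> bool" where
  "kaehler_action der smul d act \<longleftrightarrow>
    left_dop_module der act \<and>
    (\<forall>f u. act [:f:] u = smul f u) \<and>
    (\<forall>f g. act [:0, 1:] (smul f (d g)) = smul (der f) (d g) + smul f (d (der g)))"

definition kaehler_anchor ::
    "('k::field_char_0 \<Rightarrow> 'a::comm_ring_1 \<Rightarrow> 'a) \<Rightarrow> ('a \<Rightarrow> 'a) \<Rightarrow> ('a \<Rightarrow> 'a \<Rightarrow> 'a poly) \<Rightarrow>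
     ('a \<Rightarrow> 'o::ab_group_add) \<Rightarrow> ('a poly \<Rightarrow> 'o \<Rightarrow> 'o) \<Rightarrow> ('o \<Rightarrow> 'a \<Rightarrow> 'a poly) \<Rightarrow> bool" where
  "kaehler_anchor scale der pb d act \<theta> \<longleftrightarrow>
    is_anchor scale der act \<theta> \<and> (\<forall>f g. \<theta> (d f) g = pb f g)"

definition kaehler_bracket ::
    "('k::field_char_0 \<Rightarrow> 'a::comm_ring_1 \<Rightarrow> 'a) \<Rightarrow> ('a \<Rightarrow> 'a) \<Rightarrow> ('a \<Rightarrow> 'a \<Rightarrow> 'a poly) \<Rightarrow>
     ('a \<Rightarrow> 'o::ab_group_add) \<Rightarrow> ('a poly \<Rightarrow> 'o \<Rightarrow> 'o) \<Rightarrow> ('o \<Rightarrow> 'a \<Rightarrow> 'a poly) \<Rightarrow>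
     ('o \<Rightarrow> 'o \<Rightarrow> 'o poly) \<Rightarrow> bool" where
  "kaehler_bracket scale der pb d act \<theta> br \<longleftrightarrow>
    bilinear_bracket (\<lambda>c. act [:scale c 1:]) br \<and>
    (\<forall>f g. br (d f) (d g) = map_poly d (pb f g)) \<and>
    right_rule act \<theta> br \<and>
    left_rule der act \<theta> br"

end

theory Submission
  imports Defs
begin

text \<open>
  Since the ground field is infinite, an element of \<open>E[\<lambda>]\<close> is determined by its values at scalars \<open>c\<close>.
  At scalars the Jacobi identity and the anchor axiom become
  \<open>[u\<^sub>c [v\<^sub>e w]] - [v\<^sub>e [u\<^sub>c w]] = [[u\<^sub>c v]\<^sub>c\<^sub>+\<^sub>e w]\<close> and
  \<open>\<theta>(u)\<^sub>c \<theta>(v)\<^sub>e - \<theta>(v)\<^sub>e \<theta>(u)\<^sub>c = \<theta>([u\<^sub>c v])\<^sub>c\<^sub>+\<^sub>e\<close>,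
  so that only the reflection \<open>\<lambda> \<mapsto> -\<lambda>-\<partial>\<close> of skew-symmetry is a genuine substitution. It is an involution,
  and conjugating multiplication by \<open>f\<close> with it gives the operator \<open>Q \<mapsto> (|\<^sub>x\<^sub>=\<^sub>\<partial> f) Q(\<lambda>+x)\<close> of the rule (i').

  Additive maps out of the Kaehler differentials correspond to biadditive \<open>F(a,f)\<close>, the value at \<open>a df\<close>,
  with \<open>F(a,fg) = F(af,g) + F(ag,f)\<close> and \<open>F(a,cf) = F(ca,f)\<close>. This produces \<open>[df\<^sub>\<lambda> \<cdot>]\<close> by (i), then
  \<open>[\<cdot>\<^sub>\<lambda> df]\<close> by skew-symmetry, and then \<open>[u\<^sub>\<lambda> \<cdot>]\<close> by (i) again; skew-symmetry of the result turns (i) into (i').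

  The anchor axiom holds on \<open>(df, dg)\<close> by the Jacobi identity of the Poisson vertex algebra, passes from
  \<open>(u, v)\<close> to \<open>(u, fv)\<close>, and is symmetric in \<open>u\<close> and \<open>v\<close>; hence it holds everywhere. Granted this, the Jacobi
  identity for \<open>(u, v, w)\<close> implies it for \<open>(u, v, fw)\<close>, and skew-symmetry permutes its three arguments, so it
  also spreads from \<open>(df, dg, dh)\<close> to all triples.
\<close>

section \<open>Additive maps and polynomials\<close>

lemma additive_funpow: "additive T \<Longrightarrow> additive (T ^^ n)" for T :: "'e::ab_group_add \<Rightarrow> 'e"
  by (induction n) (simp_all add: additive_def)

lemma map_poly_add:
  assumes "additive f"
  shows "map_poly f (p + q) = map_poly f p + map_poly f q"
  by (rule poly_eqI) (simp add: coeff_map_poly additive.zero[OF assms] additive.add[OF assms])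

lemma additive_map_poly: "additive f \<Longrightarrow> additive (map_poly f)"
  by (simp add: additive_def map_poly_add[unfolded additive_def])

lemma map_poly_const: "f 0 = 0 \<Longrightarrow> map_poly f [:a:] = [:f a:]"
  by (simp add: map_poly_pCons)

lemma additive_pCons_0: "additive (\<lambda>p. pCons 0 p)"
  by (simp add: additive_def)

lemma additive_neg: "additive f \<Longrightarrow> additive (\<lambda>p. - f p)"
  by (simp add: additive_def)

text \<open>\<open>subst_var\<close>, \<open>poly_at\<close>, \<open>twist\<close>,
  \<open>cotwist\<close> and \<open>act\<close> all have this form. If each \<open>F n\<close> sends
  0 to 0, the bound may exceed the degree, which gives additivity and a recursion along
  \<open>pCons\<close>.\<close>

definition poly_sum :: "(nat \<Rightarrow> 'e::ab_group_add \<Rightarrow> 'm::ab_group_add) \<Rightarrow> 'e poly \<Rightarrow> 'm" where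
  "poly_sum F Q = (\<Sum>n\<le>degree Q. F n (coeff Q n))"

lemma poly_sum_bound:
  assumes "\<And>n. F n 0 = 0" "degree Q \<le> N"
  shows "poly_sum F Q = (\<Sum>n\<le>N. F n (coeff Q n))"
  unfolding poly_sum_def
  by (rule sum.mono_neutral_left) (use assms in \<open>auto simp: coeff_eq_0\<close>)

lemma poly_sum_pCons:
  assumes "\<And>n. F n 0 = 0"
  shows "poly_sum F (pCons a Q) = F 0 a + poly_sum (\<lambda>n. F (Suc n)) Q"
proof -
  have "poly_sum F (pCons a Q) = (\<Sum>n\<le>Suc (degree Q). F n (coeff (pCons a Q) n))"
    by (rule poly_sum_bound) (use assms degree_pCons_le in auto)
  also have "\<dots> = F 0 a + (\<Sum>n\<le>degree Q. F (Suc n) (coeff Q n))"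
    by (simp only: sum.atMost_Suc_shift coeff_pCons_0 coeff_pCons_Suc)
  finally show ?thesis by (simp add: poly_sum_def)
qed

lemma additive_poly_sum:
  assumes "\<And>n. additive (F n)"
  shows "additive (poly_sum F)"
proof
  fix P Q :: "'a poly"
  note z = additive.zero[OF assms]
  let ?N = "max (degree P) (degree Q)"
  have "degree (P + Q) \<le> ?N" by (rule degree_add_le) auto
  then show "poly_sum F (P + Q) = poly_sum F P + poly_sum F Q"
    by (simp add: poly_sum_bound[of F, OF z, of _ ?N] additive.add[OF assms] sum.distrib)
qed

lemma additive_comp_poly_sum: "additive h \<Longrightarrow> h (poly_sum F Q) = poly_sum (\<lambda>n e. h (F n e)) Q"
  by (simp add: poly_sum_def additive.sum)

lemma additive_pCons:
  "additive f \<Longrightarrow> f (pCons a p) = f [:a:] + f (pCons 0 p)"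
  by (metis add_0_right add_0_left add_pCons additive.add)

section \<open>The operator \<lambda>+\<partial> and substitution for the variable\<close>

lemma var_plus_pCons:
  "D 0 = 0 \<Longrightarrow> var_plus D (pCons a p) = pCons (D a) (var_plus D p + [:a:])" for p :: "'e::ab_group_add poly"
  by (simp add: var_plus_def map_poly_pCons)

lemma additive_var_plus: "additive D \<Longrightarrow> additive (var_plus D)"
  by (simp add: additive_def var_plus_def map_poly_add[unfolded additive_def])

lemma additive_neg_var_minus: "additive D \<Longrightarrow> additive (neg_var_minus D)"
  by (intro additive_neg additive_var_plus)

lemma additive_comp: "additive f \<Longrightarrow> additive g \<Longrightarrow> additive (\<lambda>x. f (g x))"
  by (simp add: additive_def)

lemma additive_const_poly: "additive (\<lambda>a. [:a:])"
  by (simp add: additive_def)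

lemma subst_var_poly_sum: "subst_var T = poly_sum (\<lambda>n e. (T ^^ n) [:e:])"
  by (rule ext) (simp add: subst_var_def poly_sum_def)

lemma additive_subst_var: "additive T \<Longrightarrow> additive (subst_var T)"
  unfolding subst_var_poly_sum
  by (intro additive_poly_sum additive_comp[OF additive_funpow additive_const_poly])

text \<open>Horner's scheme: every later computation with a substitution is an induction on this
  recursion.\<close>

lemma subst_var_pCons:
  assumes "additive T"
  shows "subst_var T (pCons a p) = [:a:] + T (subst_var T p)"
proof -
  have "(T ^^ n) [:0:] = 0" for n
    using additive.zero[OF additive_funpow[OF assms]] by simp
  then show ?thesis
    by (simp add: subst_var_poly_sum poly_sum_pCons additive_comp_poly_sum[OF assms])
qed

lemma subst_var_0: "additive T \<Longrightarrow> subst_var T 0 = 0"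
  using additive_subst_var additive.zero by blast

lemma subst_var_const: "additive T \<Longrightarrow> subst_var T [:a:] = [:a:]"
  by (simp add: subst_var_pCons subst_var_0 additive.zero)

lemma map_poly_var_plus:
  assumes h: "additive h" and D: "D 0 = 0" and comm: "\<And>x. h (D x) = D' (h x)"
  shows "map_poly h (var_plus D p) = var_plus D' (map_poly h p)"
proof -
  have "D' 0 = 0" using comm[of 0] additive.zero[OF h] D by simp
  then show ?thesis
    by (intro poly_eqI) (simp add: var_plus_def map_poly_add[OF h] map_poly_pCons additive.zero[OF h]
      coeff_map_poly comm D)
qed

lemma map_poly_uminus: "additive h \<Longrightarrow> map_poly h (- p) = - map_poly h p"
  by (rule additive.minus[OF additive_map_poly])

lemma map_poly_subst_var:
  assumes h: "additive h" and T: "additive T" "additive T'"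
    and comm: "\<And>p. map_poly h (T p) = T' (map_poly h p)"
  shows "map_poly h (subst_var T p) = subst_var T' (map_poly h p)"
proof (induction p)
  case (pCons a p)
  then show ?case
    by (simp add: subst_var_pCons T map_poly_add[OF h] comm map_poly_const map_poly_pCons additive.zero[OF h])
qed (simp add: subst_var_0 T)

subsection \<open>The substitution \<open>\<lambda> \<mapsto> -\<lambda>-\<partial>\<close>\<close>

lemma map_poly_reflect:
  assumes h: "additive h" and D: "additive D" "additive D'" and comm: "\<And>x. h (D x) = D' (h x)"
  shows "map_poly h (subst_var (neg_var_minus D) p) = subst_var (neg_var_minus D') (map_poly h p)"
  by (intro map_poly_subst_var h additive_neg_var_minus D)
    (simp add: map_poly_uminus[OF h] map_poly_var_plus[of h D D', OF h additive.zero[OF D(1)] comm])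

lemma poly_reflect_pCons:
  "additive D \<Longrightarrow> subst_var (neg_var_minus D) (pCons a p) = [:a:] - var_plus D (subst_var (neg_var_minus D) p)"
  using subst_var_pCons[OF additive_neg_var_minus] by simp

text \<open>The reflection commutes with \<partial> on coefficients and turns \<lambda> into
  -\<lambda>-\<partial>, so in the image of \<lambda>+\<partial> the two \<partial> cancel.\<close>

lemma poly_reflect_var_plus:
  assumes D: "additive D"
  shows "subst_var (neg_var_minus D) (var_plus D p) = - pCons 0 (subst_var (neg_var_minus D) p)"
proof -
  have "subst_var (neg_var_minus D) (var_plus D p)
      = subst_var (neg_var_minus D) (pCons 0 p) + subst_var (neg_var_minus D) (map_poly D p)"
    unfolding var_plus_def[of D p]
    by (rule additive.add[OF additive_subst_var[OF additive_neg_var_minus[OF D]]])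
  also have "\<dots> = - var_plus D (subst_var (neg_var_minus D) p) + map_poly D (subst_var (neg_var_minus D) p)"
    by (simp add: poly_reflect_pCons[OF D] map_poly_reflect[OF D D D refl])
  also have "\<dots> = - pCons 0 (subst_var (neg_var_minus D) p)"
    by (subst var_plus_def) simp
  finally show ?thesis .
qed

lemma poly_reflect_reflect:
  assumes D: "additive D"
  shows "subst_var (neg_var_minus D) (subst_var (neg_var_minus D) p) = p"
proof (induction p)
  case (pCons a p)
  have "subst_var (neg_var_minus D) (subst_var (neg_var_minus D) (pCons a p))
      = [:a:] - - pCons 0 (subst_var (neg_var_minus D) (subst_var (neg_var_minus D) p))"
    unfolding poly_reflect_pCons[OF D, of a p] additive.diff[OF additive_subst_var[OF additive_neg_var_minus[OF D]]]
      poly_reflect_var_plus[OF D] subst_var_const[OF additive_neg_var_minus[OF D]] ..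
  then show ?case by (simp add: pCons)
qed (simp add: subst_var_0 additive_neg_var_minus[OF D])

subsection \<open>Evaluation of polynomials at scalars\<close>

definition poly_at :: "('k::field \<Rightarrow> 'e::ab_group_add \<Rightarrow> 'e) \<Rightarrow> 'k \<Rightarrow> 'e poly \<Rightarrow> 'e" where
  "poly_at s c = poly_sum (\<lambda>n. s (c ^ n))"

context vector_space
begin

lemma additive_scale: "additive (scale c)"
  by (simp add: additive_def scale_right_distrib)

lemma additive_poly_at: "additive (poly_at scale c)"
  unfolding poly_at_def by (intro additive_poly_sum additive_scale)

lemmas poly_at_add = additive.add[OF additive_poly_at]
  and poly_at_diff = additive.diff[OF additive_poly_at]
  and poly_at_minus = additive.minus[OF additive_poly_at]
  and poly_at_zero = additive.zero[OF additive_poly_at]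

lemma poly_at_pCons: "poly_at scale c (pCons a p) = a + scale c (poly_at scale c p)"
  by (simp add: poly_at_def poly_sum_pCons additive_comp_poly_sum[OF additive_scale])

lemma poly_at_const: "poly_at scale c [:a:] = a"
  by (simp add: poly_at_pCons poly_at_zero)

lemma poly_at_var_plus:
  assumes "additive D" "\<And>c x. D (scale c x) = scale c (D x)"
  shows "poly_at scale c (var_plus D p) = scale c (poly_at scale c p) + D (poly_at scale c p)"
proof (induction p)
  case (pCons a p)
  then show ?case
    by (simp add: var_plus_pCons additive.zero assms poly_at_pCons poly_at_add poly_at_const poly_at_zero
       additive.add[OF assms(1)] algebra_simps)
qed (simp add: var_plus_def poly_at_zero poly_at_pCons additive.zero[OF assms(1)])

lemma poly_at_monom: "poly_at scale c (monom a n) = scale (c ^ n) a"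
  by (induction n) (simp_all add: monom_0 monom_Suc poly_at_const poly_at_pCons poly_at_zero)

end

lemma linear_iff_additive:
  "Vector_Spaces.linear s1 s2 h \<longleftrightarrow>
    vector_space s1 \<and> vector_space s2 \<and> additive h \<and> (\<forall>c x. h (s1 c x) = s2 c (h x))"
  unfolding Vector_Spaces.linear_iff additive_def by blast

lemma poly_at_map_poly:
  assumes "Vector_Spaces.linear s1 s2 h"
  shows "poly_at s2 c (map_poly h p) = h (poly_at s1 c p)"
proof -
  have h: "additive h" "\<And>c x. h (s1 c x) = s2 c (h x)"
    and "vector_space s1" "vector_space s2"
    using assms by (simp_all add: linear_iff_additive)
  interpret vs1: vector_space s1 by fact
  interpret vs2: vector_space s2 by fact
  show ?thesis
    by (induction p) (simp_all add: vs1.poly_at_zero vs2.poly_at_zero vs1.poly_at_pCons vs2.poly_at_pCons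
      map_poly_pCons additive.zero[OF h(1)] additive.add[OF h(1)] h(2))
qed

text \<open>A linear functional reduces this to scalar polynomials over an infinite field.\<close>

lemma poly_at_eqI:
  fixes s :: "'k::field_char_0 \<Rightarrow> 'e::ab_group_add \<Rightarrow> 'e"
  assumes "vector_space s" and eq: "\<And>c. poly_at s c p = poly_at s c q"
  shows "p = q"
proof -
  interpret vector_space s by fact
  interpret k: vector_space "(*) :: 'k \<Rightarrow> 'k \<Rightarrow> 'k"
    by unfold_locales (simp_all add: algebra_simps)
  interpret vector_space_pair s "(*) :: 'k \<Rightarrow> 'k \<Rightarrow> 'k" ..
  have "coeff (p - q) n = 0" for n
  proof (rule ccontr)
    assume nz: "coeff (p - q) n \<noteq> 0"
    then have "independent {coeff (p - q) n}" by simp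
    then obtain g where g: "Vector_Spaces.linear s (*) g" "g (coeff (p - q) n) = 1"
      using linear_independent_extend[of "{coeff (p - q) n}" "\<lambda>_. 1"] by auto
    have g0: "g 0 = 0"
      using g(1) by (simp add: linear_iff_additive additive.zero)
    have at: "poly_at (*) c r = poly r c" for c :: 'k and r
      by (induction r) (simp_all add: k.poly_at_zero k.poly_at_pCons)
    have "poly (map_poly g (p - q)) c = 0" for c
      using poly_at_map_poly[OF g(1), of c "p - q"] eq[of c] g0
      by (simp add: at poly_at_diff)
    then have "map_poly g (p - q) = 0"
      using poly_all_0_iff_0 by blast
    moreover have "coeff (map_poly g (p - q)) n = g (coeff (p - q) n)"
      using g0 by (simp add: coeff_map_poly)
    ultimately show False using g(2) by simp
  qed
  then show ?thesis
    by (metis coeff_diff eq_iff_diff_eq_0 poly_eqI)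
qed

lemma vector_space_map_poly:
  assumes "vector_space s"
  shows "vector_space (\<lambda>c. map_poly (s c))"
proof -
  interpret vector_space s by fact
  show ?thesis
    by unfold_locales (auto intro!: poly_eqI simp: coeff_map_poly algebra_simps)
qed

lemma linear_poly_at:
  assumes h: "Vector_Spaces.linear s1 (\<lambda>c. map_poly (s2 c)) h" and s2: "vector_space s2"
  shows "Vector_Spaces.linear s1 s2 (\<lambda>x. poly_at s2 c (h x))"
proof -
  interpret vector_space s2 by fact
  have "Vector_Spaces.linear s2 s2 (s2 r)" for r
    by (simp add: linear_iff_additive s2 additive_scale scale_left_commute)
  from poly_at_map_poly[OF this] h show ?thesis
    by (simp add: linear_iff_additive s2) (simp add: additive_def poly_at_add)
qed

subsection \<open>Polynomials in two variables\<close>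

definition poly2_at ::
    "('k::field \<Rightarrow> 'e::ab_group_add \<Rightarrow> 'e) \<Rightarrow> 'k \<Rightarrow> 'k \<Rightarrow> 'e poly poly \<Rightarrow> 'e" where
  "poly2_at s c e P = poly_at s e (map_poly (poly_at s c) P)"

text \<open>The one-variable principle is used twice: for the outer variable at each fixed c, then
  for each inner coefficient.\<close>

lemma poly2_at_eqI:
  fixes s :: "'k::field_char_0 \<Rightarrow> 'e::ab_group_add \<Rightarrow> 'e"
  assumes s: "vector_space s" and eq: "\<And>c e. poly2_at s c e p = poly2_at s c e q"
  shows "p = q"
proof (rule poly_eqI)
  fix n
  interpret vector_space s by fact
  have "map_poly (poly_at s c) p = map_poly (poly_at s c) q" for c
    using poly_at_eqI[OF s] eq unfolding poly2_at_def by blast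
  then have "poly_at s c (coeff p n) = poly_at s c (coeff q n)" for c
    by (metis coeff_map_poly poly_at_zero)
  then show "coeff p n = coeff q n"
    by (rule poly_at_eqI[OF s])
qed

lemma poly2_at_map_poly:
  assumes h: "Vector_Spaces.linear s1 (\<lambda>c. map_poly (s2 c)) h" and s2: "vector_space s2"
  shows "poly2_at s2 c e (map_poly h Q) = poly_at s2 c (h (poly_at s1 e Q))"
proof -
  interpret vector_space s2 by fact
  have "h 0 = 0" using h by (auto simp: linear_iff_additive intro: additive.zero)
  then have "map_poly (poly_at s2 c) (map_poly h Q) = map_poly (\<lambda>x. poly_at s2 c (h x)) Q"
    by (intro poly_eqI) (simp add: coeff_map_poly poly_at_zero)
  then show ?thesis
    unfolding poly2_at_def by (simp add: poly_at_map_poly[OF linear_poly_at[OF h s2]])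
qed

context vector_space
begin

lemma additive_poly2_at: "additive (poly2_at scale c e)"
  unfolding poly2_at_def
  by (intro additive_comp[OF additive_poly_at additive_map_poly] additive_poly_at)

lemmas poly2_at_zero = additive.zero[OF additive_poly2_at]
  and poly2_at_add = additive.add[OF additive_poly2_at]
  and poly2_at_diff = additive.diff[OF additive_poly2_at]
  and poly2_at_sum = additive.sum[OF additive_poly2_at]

lemma poly2_at_pCons: "poly2_at scale c e (pCons a p) = poly_at scale c a + scale e (poly2_at scale c e p)"
  by (simp add: poly2_at_def map_poly_pCons poly_at_zero poly_at_pCons)

lemma poly2_at_inner_pCons: "poly2_at scale c e (map_poly (pCons 0) p) = scale c (poly2_at scale c e p)"
  by (induction p)
    (simp_all add: poly2_at_zero map_poly_pCons poly2_at_pCons poly_at_pCons scale_right_distrib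
      scale_left_commute)

lemma poly2_at_monom: "poly2_at scale c e (map_poly (\<lambda>x. monom x k) p) = scale (c ^ k) (poly_at scale e p)"
  by (induction p)
    (simp_all add: poly2_at_zero poly_at_zero map_poly_pCons poly2_at_pCons poly_at_pCons poly_at_monom
      scale_right_distrib mult.commute)

lemma additive_inner_pCons: "additive (map_poly (\<lambda>p :: 'b poly. pCons 0 p))"
  by (intro additive_map_poly additive_pCons_0)

text \<open>A substitution in the outer variable is invisible at scalars except for the point: \<mu>
  = e becomes c + e, while \<lambda> = c stays.\<close>

lemma poly2_at_lam_plus_mu:
  "poly2_at scale c e (subst_var lam_plus_mu P) = poly2_at scale c (c + e) P"
proof (induction P)
  case (pCons a P)
  have T: "additive (lam_plus_mu :: 'b poly poly \<Rightarrow> _)"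
    using additive_inner_pCons by (simp add: additive_def lam_plus_mu_def)
  show ?case
    unfolding subst_var_pCons[OF T] poly2_at_add pCons.IH[symmetric] poly2_at_pCons[of _ _ _ P]
    by (simp add: poly2_at_pCons poly2_at_zero poly2_at_add lam_plus_mu_def poly2_at_inner_pCons
      scale_left_distrib poly_at_zero)
next
  case 0
  have "additive (lam_plus_mu :: 'b poly poly \<Rightarrow> _)"
    using additive_inner_pCons by (simp add: additive_def lam_plus_mu_def)
  then show ?case by (simp add: subst_var_0 poly2_at_zero)
qed

lemma poly2_at_mu_minus_lam:
  "poly2_at scale c e (subst_var mu_minus_lam P) = poly2_at scale c (e - c) P"
proof (induction P)
  case (pCons a P)
  have T: "additive (mu_minus_lam :: 'b poly poly \<Rightarrow> _)"
    using additive_inner_pCons by (simp add: additive_def mu_minus_lam_def)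
  show ?case
    unfolding subst_var_pCons[OF T] poly2_at_add pCons.IH[symmetric] poly2_at_pCons[of _ _ _ P]
    by (simp add: poly2_at_pCons poly2_at_zero poly2_at_diff mu_minus_lam_def poly2_at_inner_pCons
      scale_left_diff_distrib poly_at_zero)
next
  case 0
  have "additive (mu_minus_lam :: 'b poly poly \<Rightarrow> _)"
    using additive_inner_pCons by (simp add: additive_def mu_minus_lam_def)
  then show ?case by (simp add: subst_var_0 poly2_at_zero)
qed

end

text \<open>This covers nested terms whose inner expression carries \<lambda>: the extracted power
  of \<lambda> becomes a power of c, which linearity of \<open>h\<close> puts back inside.\<close>

lemma poly2_at_coeff_sum:
  assumes h: "Vector_Spaces.linear s1 (\<lambda>c. map_poly (s2 c)) h" and s2: "vector_space s2"
  shows "poly2_at s2 c e (\<Sum>m\<le>degree Q. map_poly (\<lambda>x. monom x m) (h (coeff Q m))) =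
    poly_at s2 e (h (poly_at s1 c Q))"
proof -
  interpret vector_space s2 by fact
  have lin: "additive (\<lambda>x. poly_at s2 e (h x))" "\<And>r x. poly_at s2 e (h (s1 r x)) = s2 r (poly_at s2 e (h x))"
    using linear_poly_at[OF h s2] by (simp_all add: linear_iff_additive)
  show ?thesis
    by (simp add: poly2_at_sum poly2_at_monom poly_at_def[of s1] poly_sum_def additive.sum[OF lin(1)] lin(2))
qed

section \<open>Differential modules\<close>

text \<open>The algebra over itself and the Kaehler differentials are both instances, so one
  calculus serves the anchor and the bracket.\<close>

locale differential_module = differential_algebra scale der + M: module smul
  for scale :: "'k::field_char_0 \<Rightarrow> 'a::comm_ring_1 \<Rightarrow> 'a"
    and der :: "'a \<Rightarrow> 'a"
    and smul :: "'a \<Rightarrow> 'e::ab_group_add \<Rightarrow> 'e" +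
  fixes D :: "'e \<Rightarrow> 'e"
  assumes additive_D: "additive D"
    and D_smul: "D (smul a u) = smul (der a) u + smul a (D u)"

context differential_algebra
begin

lemma additive_der: "additive der"
  using der_linear by (simp add: linear_iff_additive)

lemma scale_conv_mult: "scale c a = scale c 1 * a"
  using scale_mult_left[of c 1 a] by simp

lemma mult_scale_one: "(*) (scale c 1) = scale c"
  using scale_conv_mult by (metis ext)

lemma der_one: "der 1 = 0"
  using der_mult[of 1 1] by simp

lemma der_scale_one: "der (scale c 1) = 0"
  using der_linear by (simp add: linear_iff_additive der_one)

end

context differential_module
begin

abbreviation scal :: "'k \<Rightarrow> 'e \<Rightarrow> 'e" where "scal c \<equiv> smul (scale c 1)"
abbreviation reflect :: "'e poly \<Rightarrow> 'e poly" where "reflect \<equiv> subst_var (neg_var_minus D)"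
abbreviation eval :: "'k \<Rightarrow> 'e poly \<Rightarrow> 'e" where "eval \<equiv> poly_at scal"
abbreviation cmul :: "'a \<Rightarrow> 'e poly \<Rightarrow> 'e poly" where "cmul a \<equiv> map_poly (smul a)"
abbreviation vec :: "'a poly \<Rightarrow> 'e \<Rightarrow> 'e poly" where "vec A u \<equiv> map_poly (\<lambda>c. smul c u) A"

sublocale E: vector_space scal
  by unfold_locales
    (simp_all add: M.scale_right_distrib M.scale_left_distrib[symmetric] scale_left_distrib
      scale_mult_left[symmetric])

lemma D_scal: "D (scal c u) = scal c (D u)"
  by (simp add: D_smul der_scale_one)

lemma linear_D: "Vector_Spaces.linear scal scal D"
  using E.vector_space_axioms by (simp add: linear_iff_additive additive_D D_scal)

lemma additive_smul: "additive (smul a)" and additive_smul_left: "additive (\<lambda>a. smul a u)"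
  by (simp_all add: additive_def M.scale_right_distrib M.scale_left_distrib)

lemma linear_smul: "Vector_Spaces.linear scal scal (smul a)"
  using E.vector_space_axioms by (simp add: linear_iff_additive additive_smul mult.commute)

lemma additive_cmul: "additive (cmul a)"
  by (intro additive_map_poly additive_smul)

lemma additive_vec: "additive (\<lambda>A. vec A u)"
  by (intro additive_map_poly additive_smul_left)

lemma additive_vec_right: "additive (vec A)"
  by (auto simp: additive_def coeff_map_poly M.scale_right_distrib intro!: poly_eqI)

lemma map_poly_zero_fun: "map_poly (\<lambda>c. 0) A = 0"
  by (rule poly_eqI) (simp add: coeff_map_poly)

lemma vec_pCons: "vec (pCons a A) u = pCons (smul a u) (vec A u)"
  by (simp add: map_poly_pCons)

lemma additive_Lam: "additive (var_plus D)"
  by (intro additive_var_plus additive_D)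

lemma additive_reflect: "additive reflect"
  by (intro additive_subst_var additive_neg_var_minus additive_D)

lemmas reflect_minus = additive.minus[OF additive_reflect]
  and reflect_add = additive.add[OF additive_reflect]
  and cmul_add = additive.add[OF additive_cmul]
  and cmul_minus = additive.minus[OF additive_cmul]
  and Lam_add = additive.add[OF additive_Lam]

lemma vec_var_plus: "vec (var_plus der A) u = var_plus D (vec A u) - vec A (D u)"
proof -
  have "map_poly (\<lambda>c. smul c u) (map_poly der A) = map_poly D (vec A u) - vec A (D u)"
    by (rule poly_eqI)
      (simp add: coeff_map_poly additive.zero[OF additive_der] additive.zero[OF additive_D] D_smul)
  then show ?thesis
    by (simp add: var_plus_def additive.add[OF additive_vec] vec_pCons)
qed

lemma cmul_var_plus: "var_plus D (cmul f Q) = cmul (der f) Q + cmul f (var_plus D Q)"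
proof -
  have "map_poly D (cmul f Q) = cmul (der f) Q + cmul f (map_poly D Q)"
    by (rule poly_eqI) (simp add: coeff_map_poly additive.zero[OF additive_D] D_smul)
  then show ?thesis
    by (simp add: var_plus_def cmul_add map_poly_pCons)
qed

lemma cmul_vec: "cmul f (vec A u) = vec (smult f A) u"
  by (rule poly_eqI) (simp add: coeff_map_poly)

lemma vec_smul: "vec A (smul f u) = cmul f (vec A u)"
  by (rule poly_eqI) (simp add: coeff_map_poly mult.commute)

lemma cmul_cmul: "cmul f (cmul g Q) = cmul (f * g) Q"
  by (rule poly_eqI) (simp add: coeff_map_poly)

lemma cmul_one: "cmul 1 Q = Q"
  by (rule poly_eqI) (simp add: coeff_map_poly)

lemma eval_cmul: "eval c (cmul f Q) = smul f (eval c Q)"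
  by (rule poly_at_map_poly[OF linear_smul])

lemma eval_var_plus: "eval c (var_plus D Q) = scal c (eval c Q) + D (eval c Q)"
  by (rule E.poly_at_var_plus[OF additive_D D_scal])

subsection \<open>Coefficients pushed through powers of \<open>\<lambda>+\<partial>\<close>\<close>

text \<open>
  \<open>twist A Q\<close> is \<open>(|\<^sub>x\<^sub>=\<^sub>\<partial> A) Q(\<lambda>+x)\<close>, and \<open>cotwist U A\<close> is \<open>A(\<lambda>+x)(|\<^sub>x\<^sub>=\<^sub>\<partial> U)\<close>.
\<close>

definition twist :: "'a poly \<Rightarrow> 'e poly \<Rightarrow> 'e poly" where
  "twist A = poly_sum (\<lambda>n. vec ((var_plus der ^^ n) A))"

definition cotwist :: "'e poly \<Rightarrow> 'a poly \<Rightarrow> 'e poly" where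
  "cotwist U = poly_sum (\<lambda>n a. cmul a ((var_plus D ^^ n) U))"

lemma additive_cmul_left: "additive (\<lambda>a. cmul a U)"
  by (auto simp: additive_def coeff_map_poly M.scale_left_distrib intro!: poly_eqI)

lemma additive_twist: "additive (twist A)"
  unfolding twist_def by (intro additive_poly_sum additive_vec_right)

lemma additive_twist_left: "additive (\<lambda>A. twist A Q)"
  using additive_vec additive_funpow[OF additive_var_plus[OF additive_der]]
  by (simp add: twist_def poly_sum_def additive_def sum.distrib)

lemma additive_cotwist: "additive (cotwist U)"
  unfolding cotwist_def by (intro additive_poly_sum additive_cmul_left)

lemmas twist_add = additive.add[OF additive_twist]
  and twist_minus = additive.minus[OF additive_twist]
  and twist_zero = additive.zero[OF additive_twist]
  and twist_diff = additive.diff[OF additive_twist]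
  and twist_add_left = additive.add[OF additive_twist_left]
  and cotwist_zero = additive.zero[OF additive_cotwist]
  and cotwist_diff = additive.diff[OF additive_cotwist]
  and cotwist_add = additive.add[OF additive_cotwist]

lemma twist_pCons: "twist A (pCons w Q) = vec A w + twist (var_plus der A) Q"
  unfolding twist_def
  by (subst poly_sum_pCons) (simp_all add: funpow_swap1 map_poly_zero_fun)

lemma twist_const: "twist A [:w:] = vec A w"
  by (simp add: twist_pCons twist_zero)

lemma twist_pCons_0: "twist A (pCons 0 Q) = twist (var_plus der A) Q"
  by (simp add: twist_pCons map_poly_zero_fun)

lemma cotwist_pCons: "cotwist U (pCons a A) = cmul a U + cotwist (var_plus D U) A"
  unfolding cotwist_def
  by (subst poly_sum_pCons) (simp_all add: funpow_swap1 additive.zero[OF additive_cmul_left])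

lemma cotwist_const: "cotwist U [:a:] = cmul a U"
  by (simp add: cotwist_pCons cotwist_zero)

lemma twist_var_plus_left:
  "twist (var_plus der A) Q = var_plus D (twist A Q) - twist A (map_poly D Q)"
proof (induction Q arbitrary: A)
  case (pCons w Q)
  then show ?case
    by (simp add: twist_pCons vec_var_plus Lam_add map_poly_pCons additive.zero[OF additive_D])
qed (simp add: twist_zero additive.zero[OF additive_Lam])

text \<open>A factor \<lambda> in \<open>Q\<close> puts \<lambda>+\<partial> on \<open>A\<close>;
  together with \<partial> on the coefficients of \<open>Q\<close>, the Leibniz rule gives
  \<lambda>+\<partial> on the whole product.\<close>

lemma twist_var_plus: "twist A (var_plus D Q) = var_plus D (twist A Q)"
  by (subst var_plus_def) (simp add: twist_add twist_pCons_0 twist_var_plus_left)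

lemma twist_cmul: "twist A (cmul f Q) = cmul f (twist A Q)"
  by (induction Q arbitrary: A)
    (simp_all add: twist_zero map_poly_pCons twist_pCons cmul_add vec_smul del: M.scale_scale)

lemma twist_pCons_left: "twist (pCons 0 A) Q = pCons 0 (twist A Q)"
proof (induction Q arbitrary: A)
  case (pCons w Q)
  have "var_plus der (pCons 0 A) = pCons 0 (var_plus der A)"
    by (simp add: var_plus_pCons additive.zero[OF additive_der])
  then show ?case
    by (simp add: twist_pCons pCons vec_pCons)
qed (simp add: twist_zero)

section \<open>The reflection conjugates multiplication into twisting\<close>

lemma reflect_pCons: "reflect (pCons w Q) = [:w:] - var_plus D (reflect Q)"
  by (rule poly_reflect_pCons[OF additive_D])

lemma reflect_reflect: "reflect (reflect Q) = Q"
  by (rule poly_reflect_reflect[OF additive_D])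

text \<open>By Horner's scheme a reflection is built from constants and \<lambda>+\<partial>.
  Twisting commutes with \<lambda>+\<partial>, so it only multiplies the constants by
  \<open>f\<close>.\<close>

lemma twist_reflect: "twist [:f:] (reflect Q) = reflect (cmul f Q)"
  by (induction Q)
    (simp_all add: additive.zero[OF additive_reflect] twist_zero reflect_pCons map_poly_pCons twist_diff
      twist_const twist_var_plus)

lemma reflect_twist: "reflect (twist [:f:] Q) = cmul f (reflect Q)"
  by (metis twist_reflect reflect_reflect)

lemma twist_twist: "twist [:f:] (twist [:g:] Q) = twist [:f * g:] Q"
  by (metis twist_reflect reflect_reflect cmul_cmul)

lemma twist_one: "twist [:1:] Q = Q"
  by (metis twist_reflect reflect_reflect map_poly_id' M.scale_one map_poly_cong)

lemma cotwist_var_plus: "cotwist U (var_plus der A) = var_plus D (cotwist U A)"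
proof (induction A arbitrary: U)
  case (pCons a A)
  have "cotwist U (var_plus der (pCons a A)) = cmul (der a) U + (cotwist (var_plus D U) [:a:]
      + cotwist (var_plus D U) (var_plus der A))"
    by (simp only: var_plus_pCons additive.zero[OF additive_der] cotwist_pCons cotwist_add) (simp only: add_ac)
  also have "\<dots> = var_plus D (cotwist U (pCons a A))"
    by (simp add: cotwist_const cotwist_zero pCons cotwist_pCons Lam_add cmul_var_plus)
  finally show ?case .
qed (simp add: var_plus_def cotwist_zero)

lemma cotwist_smult: "cotwist U (smult f A) = cmul f (cotwist U A)"
  by (induction A arbitrary: U) (simp_all add: cotwist_zero cotwist_pCons cmul_add cmul_cmul)

subsection \<open>Translations of the variable\<close>

text \<open>
  A translation \<open>\<lambda> \<mapsto> \<lambda>+c\<close> becomes \<open>\<lambda> \<mapsto> \<lambda>-c\<close> after the reflection, and conjugating by reflections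
  turns multiplication by \<open>f\<close> into \<open>twist [:f:]\<close>.
\<close>

lemma eval_reflect_translate:
  assumes "\<And>e. eval e P = eval (c + e) Q"
  shows "eval (c + e) (reflect P) = eval e (reflect Q)"
proof -
  \<comment> \<open>\<open>?T\<close> is multiplication by \<lambda>+c, so
    \<open>subst_var ?T Q\<close> is the translate Q(\<lambda>+c), and values at scalars identify it
    with \<open>P\<close>.\<close>
  let ?T = "\<lambda>P. pCons 0 P + cmul (scale c 1) P"
  have T: "additive ?T" using additive_cmul[of "scale c 1"] by (simp add: additive_def)
  have "eval r (subst_var ?T Q) = eval (c + r) Q" for r
    by (induction Q)
      (simp_all add: subst_var_0[OF T] subst_var_pCons[OF T] E.poly_at_zero E.poly_at_add E.poly_at_pCons
        eval_cmul M.scale_left_distrib scale_left_distrib add_ac)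
  with assms have "P = subst_var ?T Q"
    by (intro poly_at_eqI[OF E.vector_space_axioms]) simp
  moreover have "eval (c + e) (reflect (subst_var ?T Q)) = eval e (reflect Q)"
  proof (induction Q)
    case (pCons w Q)
    have "reflect (cmul (scale c 1) P) = cmul (scale c 1) (reflect P)" for P
      by (rule map_poly_reflect[symmetric]) (simp_all add: additive_smul additive_D D_scal)
    then have "reflect (subst_var ?T (pCons w Q)) = [:w:] - var_plus D (reflect (subst_var ?T Q))
       + cmul (scale c 1) (reflect (subst_var ?T Q))"
      by (simp add: subst_var_pCons[OF T] reflect_add reflect_pCons additive.zero[OF additive_reflect]
        additive.zero[OF additive_Lam])
    then show ?case
      by (simp add: pCons reflect_pCons E.poly_at_add E.poly_at_diff E.poly_at_const eval_var_plus eval_cmul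
        M.scale_left_distrib scale_left_distrib)
  qed (simp add: subst_var_0[OF T] additive.zero[OF additive_reflect] E.poly_at_zero)
  ultimately show ?thesis by simp
qed

lemma eval_twist_translate:
  assumes "\<And>e. eval e P = eval (c + e) Q"
  shows "eval e (twist [:f:] P) = eval (c + e) (twist [:f:] Q)"
proof -
  have "eval r (cmul f (reflect Q)) = eval (c + r) (cmul f (reflect P))" for r
    by (simp add: eval_cmul eval_reflect_translate[OF assms])
  then have "eval (c + e) (reflect (cmul f (reflect Q))) = eval e (reflect (cmul f (reflect P)))"
    by (rule eval_reflect_translate)
  then show ?thesis
    by (simp add: twist_reflect[symmetric] reflect_reflect)
qed

text \<open>Under \<open>h\<close> the operator \<partial> acts as -(c+e), hence -e-\<partial> acts
  as c.\<close>

lemma eval_reflect_eq: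
  assumes "Vector_Spaces.linear scal s h" "\<And>u. h (D u) = - s (c + e) (h u)"
  shows "h (eval e (reflect Q)) = h (eval c Q)"
proof -
  have h: "additive h" "\<And>r u. h (scal r u) = s r (h u)" and "vector_space s"
    using assms(1) by (simp_all add: linear_iff_additive)
  interpret s: vector_space s by fact
  show ?thesis
  proof (induction Q)
    case (pCons w Q)
    then show ?case
      by (simp add: reflect_pCons E.poly_at_diff E.poly_at_const E.poly_at_pCons E.poly_at_zero eval_var_plus additive.diff[OF h(1)]
        additive.add[OF h(1)] h(2) assms(2) s.scale_left_distrib)
  qed (simp add: additive.zero[OF additive_reflect] E.poly_at_zero)
qed

text \<open>Moving \<open>h\<close> past \<partial> replaces \<partial> by c+\<partial>, so
  -e-\<partial> becomes -(c+e)-\<partial>.\<close>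

lemma eval_reflect_map_poly:
  assumes "Vector_Spaces.linear scal scal h" "\<And>u. h (D u) = scal c (h u) + D (h u)"
  shows "h (eval e (reflect Q)) = eval (c + e) (reflect (map_poly h Q))"
proof -
  have h: "additive h" "\<And>r u. h (scal r u) = scal r (h u)"
    using assms(1) by (simp_all add: linear_iff_additive)
  show ?thesis
  proof (induction Q)
    case (pCons w Q)
    then show ?case
      by (simp add: reflect_pCons E.poly_at_diff E.poly_at_const E.poly_at_pCons E.poly_at_zero eval_var_plus additive.diff[OF h(1)]
        additive.add[OF h(1)] h(2) assms(2) map_poly_pCons additive.zero[OF h(1)] M.scale_left_distrib scale_left_distrib)
  qed (simp add: additive.zero[OF additive_reflect] E.poly_at_zero additive.zero[OF h(1)])
qed

end

context differential_algebra
begin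

sublocale V: differential_module scale der "(*)" der
  by unfold_locales (simp_all add: additive.add[OF additive_der] der_mult algebra_simps)

end

section \<open>Algebra-valued polynomials acting on module elements\<close>

context differential_module
begin

lemma eval_vec: "eval c (vec A u) = smul (V.eval c A) u"
  by (rule poly_at_map_poly)
    (simp add: linear_iff_additive E.vector_space_axioms V.E.vector_space_axioms additive_smul_left)

lemma vec_V_vec: "vec (V.vec A p) u = vec A (smul p u)"
  by (rule poly_eqI) (simp add: coeff_map_poly)

lemma twist_vec: "twist A (vec P u) = vec (V.twist A P) u"
  by (induction P arbitrary: A)
    (simp_all add: twist_zero V.twist_zero twist_pCons V.twist_pCons vec_pCons vec_V_vec
      additive.add[OF additive_vec])

text \<open>Both sides obey the same Horner recursion, since \<open>cotwist\<close> intertwines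
  \<lambda>+\<partial> on the algebra and on the module. Thus the anchor term of (i') is the
  reflection of the anchor term of (i).\<close>

lemma cotwist_reflect: "cotwist [:u:] (V.reflect A) = reflect (vec A u)"
  by (induction A)
    (simp_all add: additive.zero[OF additive_reflect] additive.zero[OF V.additive_reflect] cotwist_zero
      vec_pCons V.reflect_pCons reflect_pCons cotwist_diff cotwist_const cotwist_var_plus map_poly_const)

text \<open>Twisting by (\<lambda>+\<partial>)A is twisting \<lambda>Q by A. So the adjoint symbol
  of a(\<partial>) acts by powers of -\<lambda> followed by twists by the coefficients, which
  reduces rules for a(\<partial>) to functions and \<partial>.\<close>

lemma twist_adj_symbol:
  "twist (V.reflect a) Q = (\<Sum>i\<le>degree a. twist [:coeff a i:] (((\<lambda>P. - pCons 0 P) ^^ i) Q))"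
proof -
  have F0: "additive (\<lambda>c. twist [:c:] P)" for P
    by (rule additive_comp[OF additive_twist_left additive_const_poly])
  have "twist (V.reflect a) Q = poly_sum (\<lambda>i c. twist [:c:] (((\<lambda>P. - pCons 0 P) ^^ i) Q)) a"
  proof (induction a arbitrary: Q)
    case (pCons c a)
    have "twist (V.reflect (pCons c a)) Q = twist [:c:] Q + twist (V.reflect a) (- pCons 0 Q)"
      by (simp add: V.reflect_pCons additive.diff[OF additive_twist_left] twist_minus twist_pCons_0
        del: minus_pCons)
    also have "\<dots> = poly_sum (\<lambda>i c. twist [:c:] (((\<lambda>P. - pCons 0 P) ^^ i) Q)) (pCons c a)"
      unfolding pCons.IH
      by (subst poly_sum_pCons) (simp_all only: additive.zero[OF F0] funpow_0 funpow_Suc_right o_apply)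
    finally show ?case .
  qed (simp add: additive.zero[OF V.additive_reflect] additive.zero[OF additive_twist_left] poly_sum_def)
  then show ?thesis by (simp add: poly_sum_def)
qed

text \<open>At \<lambda> = e each power of \<lambda>+\<partial> applied to \<open>A\<close> becomes
  the same power of e+\<partial> applied to the value of \<open>A\<close> at e.\<close>

lemma eval_twist: "eval e (twist A Q) = eval e (twist [:V.eval e A:] Q)"
proof (induction Q arbitrary: A)
  case (pCons w Q)
  have "eval e (twist (var_plus der A) Q) = eval e (twist (var_plus der [:V.eval e A:]) Q)"
    by (subst (1 2) pCons) (simp add: V.eval_var_plus V.E.poly_at_const)
  then show ?case
    by (simp add: twist_pCons E.poly_at_add eval_vec V.E.poly_at_const)
qed (simp add: twist_zero)

end

text \<open>\<open>X\<close> is a conformal derivation frozen at the scalar c. Since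
  X(ef+\<partial>f) = (c+e+\<partial>)X(f), the part where \<open>X\<close> hits \<open>f\<close>
  moves to the point c+e, and the part where it hits \<open>Q\<close> stays at e.\<close>

lemma (in differential_algebra) derivation_eval_twist:
  assumes lin: "Vector_Spaces.linear scale scale X"
    and der: "\<And>a. X (der a) = scale c (X a) + der (X a)"
    and mult: "\<And>a b. X (a * b) = X a * b + a * X b"
  shows "X (V.eval e (V.twist [:f:] Q)) =
    V.eval (c + e) (V.twist [:X f:] Q) + V.eval e (V.twist [:f:] (map_poly X Q))"
proof -
  have X: "additive X" "\<And>r u. X (scale r u) = scale r (X u)"
    using lin by (simp_all add: linear_iff_additive)
  have step: "V.eval r (V.twist (var_plus der [:g:]) P) = V.eval r (V.twist [:scale r g + der g:] P)" for r g P
    by (subst V.eval_twist)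
      (simp add: V.eval_var_plus V.E.poly_at_const scale_conv_mult[of r g])
  show ?thesis
  proof (induction Q arbitrary: f)
    case (pCons w Q)
    have *: "X (scale e f) + X (der f) = scale (c + e) (X f) + der (X f)"
      by (simp add: additive.add[OF X(1)] X(2) der scale_left_distrib)
    show ?case
      by (simp add: V.twist_pCons V.E.poly_at_add V.eval_vec V.E.poly_at_const step additive.add[OF X(1)]
        mult pCons * map_poly_pCons additive.zero[OF X(1)])
  qed (simp add: V.twist_zero V.E.poly_at_zero additive.zero[OF X(1)])
qed

section \<open>Additive maps out of the Kaehler differentials\<close>

definition keys_sum :: "('a \<Rightarrow> 'c \<Rightarrow> 'm::ab_group_add) \<Rightarrow> ('c \<Rightarrow>\<^sub>0 'a::ab_group_add) \<Rightarrow> 'm" where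
  "keys_sum F m = (\<Sum>f\<in>Poly_Mapping.keys m. F (Poly_Mapping.lookup m f) f)"

lemma additive_keys_sum:
  fixes F :: "'a::ab_group_add \<Rightarrow> 'c \<Rightarrow> 'm::ab_group_add"
  assumes F: "\<And>f. additive (\<lambda>a. F a f)"
  shows "additive (keys_sum F)"
proof
  fix m n :: "'c \<Rightarrow>\<^sub>0 'a"
  let ?S = "Poly_Mapping.keys m \<union> Poly_Mapping.keys n"
  have "keys_sum F p = (\<Sum>f\<in>?S. F (Poly_Mapping.lookup p f) f)" if "Poly_Mapping.keys p \<subseteq> ?S" for p
    unfolding keys_sum_def
    by (rule sum.mono_neutral_left) (use that additive.zero[OF F] in \<open>auto simp: in_keys_iff\<close>)
  then show "keys_sum F (m + n) = keys_sum F m + keys_sum F n"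
    by (simp add: Poly_Mapping.keys_add lookup_add additive.add[OF F] sum.distrib)
qed

lemma keys_sum_single: "(\<And>f. F 0 f = 0) \<Longrightarrow> keys_sum F (Poly_Mapping.single f a) = F a f"
  by (simp add: keys_sum_def)

lemma lookup_free_smul: "Poly_Mapping.lookup (free_smul a m) k = a * Poly_Mapping.lookup m k"
  by (simp add: Poly_Mapping.map.rep_eq when_def)

lemma module_free_smul: "module (free_smul :: 'a::comm_ring_1 \<Rightarrow> _)"
  by unfold_locales (auto intro!: poly_mapping_eqI simp: lookup_free_smul lookup_add algebra_simps)

context kaehler_differentials
begin

text \<open>The value is computed on a chosen preimage in the free module; for extendible
  \<open>F\<close> the choice does not matter.\<close>

definition additive_ext :: "('a \<Rightarrow> 'a \<Rightarrow> 'm::ab_group_add) \<Rightarrow> 'o \<Rightarrow> 'm" where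
  "additive_ext F u = keys_sum F (SOME m. keys_sum (\<lambda>a f. smul a (d f)) m = u)"

text \<open>These conditions make \<open>F\<close> kill all multiples of the Kaehler relations. The
  coefficient is an argument of \<open>F\<close> because the maps to be built are additive but not
  linear over the algebra.\<close>

definition extendible :: "('a \<Rightarrow> 'a \<Rightarrow> 'm::ab_group_add) \<Rightarrow> bool" where
  "extendible F \<longleftrightarrow>
    (\<forall>f. additive (\<lambda>a. F a f)) \<and> (\<forall>a. additive (F a)) \<and>
    (\<forall>a c f. F a (scale c f) = F (a * scale c 1) f) \<and>
    (\<forall>a f g. F a (f * g) = F (a * f) g + F (a * g) f)"

lemma keys_sum_gen: "keys_sum (\<lambda>a f. smul a (d f)) (Poly_Mapping.single f a) = smul a (d f)"
  by (rule keys_sum_single) simp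

lemma additive_keys_sum_d: "additive (keys_sum (\<lambda>a f. smul a (d f)))"
  by (rule additive_keys_sum) (simp add: additive_def scale_left_distrib)

lemma keys_sum_relation:
  assumes F: "extendible F" and m: "keys_sum (\<lambda>a f. smul a (d f)) m = 0"
  shows "keys_sum F m = 0"
proof -
  interpret free: module "free_smul :: 'a \<Rightarrow> _" by (rule module_free_smul)
  have F1: "\<And>f. additive (\<lambda>a. F a f)" and F2: "\<And>a. additive (F a)"
    and F3: "\<And>a c f. F a (scale c f) = F (a * scale c 1) f"
    and F4: "\<And>a f g. F a (f * g) = F (a * f) g + F (a * g) f"
    using F by (simp_all add: extendible_def)
  note F0 = additive.zero[OF F1]
  note A = additive_keys_sum[of F, OF F1]
  have "m \<in> free.span (kaehler_relations scale)"
    using m presented by (simp add: keys_sum_def)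
  then show ?thesis
  proof (induction rule: free.span_induct_alt)
    case base
    show ?case by (rule additive.zero[OF A])
  next
    case (step c x y)
    then consider f g where "x = Poly_Mapping.single (f + g) 1 - Poly_Mapping.single f 1 - Poly_Mapping.single g 1"
      | r f where "x = Poly_Mapping.single (scale r f) 1 - Poly_Mapping.single f (scale r 1)"
      | f g where "x = Poly_Mapping.single (f * g) 1 - Poly_Mapping.single g f - Poly_Mapping.single f g"
      unfolding kaehler_relations_def by blast
    then have "keys_sum F (free_smul c x) = 0"
      by cases (simp_all add: free.scale_right_diff_distrib additive.diff[OF A] map_single
        keys_sum_single[of F, OF F0] additive.add[OF F2] F3 F4)
    with step show ?case by (simp add: additive.add[OF A])
  qed
qed

lemma additive_ext_keys_sum:
  assumes F: "extendible F"
  shows "additive_ext F (keys_sum (\<lambda>a f. smul a (d f)) m) = keys_sum F m"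
proof -
  let ?T = "keys_sum (\<lambda>a f. smul a (d f))"
  define n where "n = (SOME n. ?T n = ?T m)"
  have "?T n = ?T m" unfolding n_def by (rule someI) (rule refl)
  then have "?T (n - m) = 0" by (simp add: additive.diff[OF additive_keys_sum_d])
  then have "keys_sum F (n - m) = 0" by (rule keys_sum_relation[OF F])
  moreover have "additive (keys_sum F)"
    using F by (intro additive_keys_sum) (simp add: extendible_def)
  ultimately show ?thesis
    by (simp add: additive_ext_def n_def additive.diff)
qed

lemma obtain_keys_sum: obtains m where "keys_sum (\<lambda>a f. smul a (d f)) m = u"
proof -
  obtain m where "u = (\<Sum>f\<in>Poly_Mapping.keys m. smul (Poly_Mapping.lookup m f) (d f))"
    using surjD[OF generated, of u] by blast
  then show thesis by (intro that[of m]) (simp add: keys_sum_def)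
qed

lemma additive_additive_ext:
  assumes F: "extendible F"
  shows "additive (additive_ext F)"
proof
  fix u v
  obtain m where m: "keys_sum (\<lambda>a f. smul a (d f)) m = u" by (rule obtain_keys_sum)
  obtain n where n: "keys_sum (\<lambda>a f. smul a (d f)) n = v" by (rule obtain_keys_sum)
  have "additive (keys_sum F)"
    using F by (intro additive_keys_sum) (simp add: extendible_def)
  then show "additive_ext F (u + v) = additive_ext F u + additive_ext F v"
    unfolding m[symmetric] n[symmetric] additive.add[OF additive_keys_sum_d, symmetric]
      additive_ext_keys_sum[OF F] by (rule additive.add)
qed

lemma additive_ext_gen:
  assumes F: "extendible F"
  shows "additive_ext F (smul a (d f)) = F a f"
proof -
  have "F 0 g = 0" for g using F by (auto simp: extendible_def intro: additive.zero)
  then show ?thesis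
    using additive_ext_keys_sum[OF F, of "Poly_Mapping.single f a"]
    by (simp add: keys_sum_gen keys_sum_single)
qed

lemma kaehler_induct [case_names add gen]:
  assumes add: "\<And>u v. P u \<Longrightarrow> P v \<Longrightarrow> P (u + v)" and gen: "\<And>a f. P (smul a (d f))"
  shows "P u"
proof -
  have "P (\<Sum>f\<in>S. smul (r f) (d f))" if "finite S" for S r
    using that
  proof induction
    case empty
    \<comment> \<open>The empty sum is a generator with coefficient 0, so any symbol will
      do.\<close>
    then show ?case using gen[of 0 undefined] by simp
  qed (simp add: add gen)
  moreover obtain m where "keys_sum (\<lambda>a f. smul a (d f)) m = u" by (rule obtain_keys_sum)
  ultimately show ?thesis by (auto simp: keys_sum_def)
qed

lemma additive_eq_on_gen:
  assumes "additive h" "additive h'" "\<And>a f. h (smul a (d f)) = h' (smul a (d f))"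
  shows "h u = h' u"
  by (induction u rule: kaehler_induct) (simp_all add: assms additive.add)

section \<open>The universal derivation\<close>

lemma d_relation: "m \<in> kaehler_relations scale \<Longrightarrow> keys_sum (\<lambda>a f. smul a (d f)) m = 0"
  using presented[of m] module.span_base[OF module_free_smul] by (simp add: keys_sum_def)

lemma additive_d: "additive d"
proof
  fix f g
  have "Poly_Mapping.single (f + g) 1 - Poly_Mapping.single f 1 - Poly_Mapping.single g 1 \<in> kaehler_relations scale"
    unfolding kaehler_relations_def by blast
  from d_relation[OF this] show "d (f + g) = d f + d g"
    by (simp add: additive.diff[OF additive_keys_sum_d] keys_sum_gen diff_eq_eq add.commute)
qed

lemma d_scale: "d (scale c f) = smul (scale c 1) (d f)"
proof -
  have "Poly_Mapping.single (scale c f) 1 - Poly_Mapping.single f (scale c 1) \<in> kaehler_relations scale"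
    unfolding kaehler_relations_def by blast
  from d_relation[OF this] show ?thesis
    by (simp add: additive.diff[OF additive_keys_sum_d] keys_sum_gen)
qed

lemma d_mult: "d (f * g) = smul f (d g) + smul g (d f)"
proof -
  have "Poly_Mapping.single (f * g) 1 - Poly_Mapping.single g f - Poly_Mapping.single f g \<in> kaehler_relations scale"
    unfolding kaehler_relations_def by blast
  from d_relation[OF this] show ?thesis
    by (simp add: additive.diff[OF additive_keys_sum_d] keys_sum_gen diff_eq_eq add.commute)
qed

end

section \<open>The algebroid structure on Kaehler differentials\<close>

locale poisson_kaehler = poisson_vertex_algebra scale der pb + K: kaehler_differentials scale smul d
  for scale :: "'k::field_char_0 \<Rightarrow> 'a::comm_ring_1 \<Rightarrow> 'a"
    and der :: "'a \<Rightarrow> 'a"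
    and pb :: "'a \<Rightarrow> 'a \<Rightarrow> 'a poly"
    and smul :: "'a \<Rightarrow> 'o::ab_group_add \<Rightarrow> 'o"
    and d :: "'a \<Rightarrow> 'o"
begin

section \<open>The derivation on Kaehler differentials\<close>

definition dK :: "'o \<Rightarrow> 'o" where
  "dK = K.additive_ext (\<lambda>a g. smul (der a) (d g) + smul a (d (der g)))"

lemma extendible_dK: "K.extendible (\<lambda>a g. smul (der a) (d g) + smul a (d (der g)))"
proof -
  have "der (scale c f) = scale c (der f)" for c f
    using D_linear by (simp add: linear_iff_additive)
  then show ?thesis
    unfolding K.extendible_def additive_def
    by (auto simp: additive.add[OF additive_der] additive.add[OF K.additive_d] K.d_mult K.d_scale
        der_mult der_one der_scale_one K.scale_left_distrib K.scale_right_distrib mult.commute)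
qed

lemma dK_gen: "dK (smul a (d g)) = smul (der a) (d g) + smul a (d (der g))"
  unfolding dK_def by (rule K.additive_ext_gen[OF extendible_dK])

lemma additive_dK: "additive dK"
  unfolding dK_def by (rule K.additive_additive_ext[OF extendible_dK])

lemma dK_smul: "dK (smul a u) = smul (der a) u + smul a (dK u)"
  by (induction u rule: K.kaehler_induct)
    (simp_all add: additive.add[OF additive_dK] K.scale_right_distrib dK_gen der_mult K.scale_left_distrib)

lemma dK_d: "dK (d f) = d (der f)"
  using dK_gen[of 1 f] by (simp add: der_one)

sublocale O: differential_module scale der smul dK
  by unfold_locales (simp_all add: additive_dK additive.add[OF additive_dK] dK_smul)

end

context poisson_kaehler
begin

lemma linear_pb: "Vector_Spaces.linear scale (\<lambda>c. map_poly (scale c)) (pb f)"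
  and linear_pb_left: "Vector_Spaces.linear scale (\<lambda>c. map_poly (scale c)) (\<lambda>f. pb f g)"
  using bilinear by (simp_all add: bilinear_bracket_def)

lemma additive_pb: "additive (pb f)" and additive_pb_left: "additive (\<lambda>f. pb f g)"
  and pb_scale: "pb f (scale c g) = map_poly (scale c) (pb f g)"
  and pb_scale_left: "pb (scale c f) g = map_poly (scale c) (pb f g)"
  using linear_pb linear_pb_left by (simp_all add: linear_iff_additive)

lemma cmul_scale_one: "V.cmul (scale c 1) = map_poly (scale c)"
  by (simp add: mult_scale_one)

lemma leibniz_cmul: "pb f (g * h) = V.cmul g (pb f h) + V.cmul h (pb f g)"
  by (simp add: leibniz smult_conv_map_poly)

text \<open>Skew-symmetry moves the product to the right-hand slot, and reflecting back turns
  multiplications into twists.\<close>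

lemma pb_mult_left: "pb (f * g) h = V.twist [:f:] (pb g h) + V.twist [:g:] (pb f h)"
  by (subst (1 2 3) skew)
    (simp add: leibniz_cmul V.reflect_add V.twist_reflect V.twist_minus)

subsection \<open>The anchor\<close>

text \<open>The value on a dg is forced: multiplication by a function on conformal derivations is
  the twist by that function.\<close>

definition theta :: "'o \<Rightarrow> 'a \<Rightarrow> 'a poly" where
  "theta u h = K.additive_ext (\<lambda>a g. V.twist [:a:] (pb g h)) u"

lemma twist_map_scale: "V.twist A (map_poly (scale c) Q) = map_poly (scale c) (V.twist A Q)"
  using V.twist_cmul[of A "scale c 1" Q] by (simp add: cmul_scale_one)

lemma twist_scale_one: "V.twist [:scale c 1:] Q = map_poly (scale c) Q"
proof -
  have "V.reflect (map_poly (scale c) P) = map_poly (scale c) (V.reflect P)" for P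
    using V.D_scal
    by (intro map_poly_reflect[symmetric] additive_der) (simp_all add: additive_scale mult_scale_one)
  then show ?thesis
    using V.twist_reflect[of "scale c 1" "V.reflect Q"] by (simp add: V.reflect_reflect cmul_scale_one)
qed

lemma twist_map_scale_left: "V.twist [:a:] (map_poly (scale c) Q) = V.twist [:a * scale c 1:] Q"
  by (simp add: twist_scale_one[symmetric] V.twist_twist)

lemma extendible_theta: "K.extendible (\<lambda>a g. V.twist [:a:] (pb g h))"
  unfolding K.extendible_def
proof (intro conjI allI)
  show "additive (\<lambda>a. V.twist [:a:] (pb f h))" for f
    by (rule additive_comp[OF V.additive_twist_left additive_const_poly])
  show "additive (\<lambda>g. V.twist [:a:] (pb g h))" for a
    by (rule additive_comp[OF V.additive_twist additive_pb_left])
qed (simp_all add: pb_scale_left twist_map_scale_left pb_mult_left V.twist_add V.twist_twist mult.commute)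

lemma theta_gen: "theta (smul a (d g)) h = V.twist [:a:] (pb g h)"
  unfolding theta_def by (rule K.additive_ext_gen[OF extendible_theta])

lemma additive_theta: "additive (\<lambda>u. theta u h)"
  unfolding theta_def by (rule K.additive_additive_ext[OF extendible_theta])

lemmas theta_add_left = additive.add[OF additive_theta]

lemma theta_d: "theta (d g) h = pb g h"
  using theta_gen[of 1 g h] by (simp add: V.twist_one)

lemma theta_add: "theta u (h + h') = theta u h + theta u h'"
  by (induction u rule: K.kaehler_induct)
    (simp_all add: theta_add_left theta_gen additive.add[OF additive_pb] V.twist_add)

lemma additive_theta_right: "additive (theta u)"
  by (simp add: additive_def theta_add)

lemma theta_scale: "theta u (scale c h) = map_poly (scale c) (theta u h)"
  by (induction u rule: K.kaehler_induct)
    (simp_all add: theta_add_left theta_gen pb_scale twist_map_scale map_poly_add additive_scale)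

lemma theta_der: "theta u (der h) = var_plus der (theta u h)"
  by (induction u rule: K.kaehler_induct)
    (simp_all add: theta_add_left theta_gen sesquilinear_right V.twist_var_plus V.Lam_add)

lemma theta_mult: "theta u (g * h) = V.cmul g (theta u h) + V.cmul h (theta u g)"
  by (induction u rule: K.kaehler_induct)
    (simp_all add: theta_add_left theta_gen leibniz_cmul V.twist_add V.twist_cmul V.cmul_add)

lemma theta_one: "theta u 1 = 0"
  using theta_mult[of u 1 1] by (metis mult_1 add_cancel_right_right V.cmul_one)

lemma linear_theta: "Vector_Spaces.linear scale (\<lambda>c. map_poly (scale c)) (theta u)"
  using vector_space_axioms vector_space_map_poly[OF vector_space_axioms]
  by (simp add: linear_iff_additive additive_theta_right theta_scale)

lemma theta_CDer: "theta u \<in> CDer scale der"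
  unfolding CDer_def by (auto simp: linear_theta theta_der theta_mult smult_conv_map_poly add.commute)

lemma theta_smul: "theta (smul f u) h = V.twist [:f:] (theta u h)"
  by (induction u rule: K.kaehler_induct)
    (simp_all add: K.scale_right_distrib theta_add_left theta_gen V.twist_add V.twist_twist)

lemma theta_dK: "theta (dK u) h = - pCons 0 (theta u h)"
proof (induction u rule: K.kaehler_induct)
  case (gen a g)
  \<comment> \<open>Pushing -\<lambda> through the twist gives -(\<lambda>+\<partial>)a; its
    \<partial> part cancels the summand with \<open>der a\<close> in \<open>dK\<close>.\<close>
  have "V.twist [:a:] (- pCons 0 (pb g h)) = - V.twist (var_plus der [:a:]) (pb g h)"
    by (simp add: V.twist_minus V.twist_pCons_0 del: minus_pCons)
  also have "var_plus der [:a:] = [:der a:] + pCons 0 [:a:]"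
    by (simp add: var_plus_def map_poly_const additive.zero[OF additive_der])
  finally show ?case
    by (simp add: dK_gen theta_add_left theta_gen sesquilinear_left V.twist_add_left V.twist_pCons_left
      del: minus_pCons add_pCons)
qed (simp add: theta_add_left additive.add[OF additive_dK])

lemma theta_scal: "theta (O.scal c u) h = map_poly (scale c) (theta u h)"
  by (simp add: theta_smul twist_scale_one)

subsection \<open>The bracket\<close>

text \<open>\<open>lbr g u\<close> is \<open>[dg\<^sub>\<lambda> u]\<close>, and \<open>rbr g u\<close> is \<open>[u\<^sub>\<lambda> dg]\<close>, obtained from it by skew-symmetry.\<close>

abbreviation dpoly :: "'a poly \<Rightarrow> 'o poly" where "dpoly \<equiv> map_poly d"

definition lbr :: "'a \<Rightarrow> 'o \<Rightarrow> 'o poly" where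
  "lbr f = K.additive_ext (\<lambda>a g. O.cmul a (dpoly (pb f g)) + O.vec (pb f a) (d g))"

definition rbr :: "'a \<Rightarrow> 'o \<Rightarrow> 'o poly" where
  "rbr g u = - O.reflect (lbr g u)"

definition br :: "'o \<Rightarrow> 'o \<Rightarrow> 'o poly" where
  "br u = K.additive_ext (\<lambda>a g. O.cmul a (rbr g u) + O.vec (theta u a) (d g))"

lemma dpoly_cmul: "dpoly (V.cmul f Q) = O.cmul f (dpoly Q) + O.vec Q (d f)"
  by (rule poly_eqI) (simp add: coeff_map_poly additive.zero[OF K.additive_d] K.d_mult)

lemma dpoly_scale: "dpoly (map_poly (scale c) Q) = O.cmul (scale c 1) (dpoly Q)"
  by (rule poly_eqI) (simp add: coeff_map_poly additive.zero[OF K.additive_d] K.d_scale)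

lemma dpoly_add: "dpoly (P + Q) = dpoly P + dpoly Q"
  by (rule map_poly_add[OF K.additive_d])

lemma dpoly_reflect: "dpoly (V.reflect Q) = O.reflect (dpoly Q)"
  by (rule map_poly_reflect[OF K.additive_d additive_der additive_dK]) (simp add: dK_d)

lemma O_vec_add: "O.vec (A + B) u = O.vec A u + O.vec B u"
  and O_vec_add_right: "O.vec A (u + v) = O.vec A u + O.vec A v"
  by (rule additive.add[OF O.additive_vec] additive.add[OF O.additive_vec_right])+

lemma O_cmul_add_left: "O.cmul (a + b) Q = O.cmul a Q + O.cmul b Q"
  by (rule additive.add[OF O.additive_cmul_left])

lemma O_cmul_vec: "O.cmul f (O.vec A u) = O.vec (V.cmul f A) u"
  by (simp add: O.cmul_vec smult_conv_map_poly)

text \<open>\<open>R g\<close> stands for the bracket of a fixed left argument with dg, and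
  \<open>X\<close> for its anchor. The cross terms in the product law of \<open>R\<close> are those
  which \<open>X\<close> produces when a factor of the product becomes a coefficient.\<close>

lemma extendible_bracket:
  assumes R: "\<And>g h. R (g + h) = R g + R h" "\<And>c g. R (scale c g) = O.cmul (scale c 1) (R g)"
      "\<And>g h. R (g * h) = O.cmul g (R h) + O.cmul h (R g) + (O.vec (X g) (d h) + O.vec (X h) (d g))"
    and X: "\<And>g h. X (g + h) = X g + X h" "\<And>c g. X (scale c g) = map_poly (scale c) (X g)"
      "\<And>g h. X (g * h) = V.cmul g (X h) + V.cmul h (X g)"
  shows "K.extendible (\<lambda>a g. O.cmul a (R g) + O.vec (X a) (d g))"
proof -
  \<comment> \<open>\<open>X\<close> must kill scalars, so that they pass freely between
    \<open>d\<close> and the coefficient.\<close>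
  have "X 1 = X 1 + X 1" using X(3)[of 1 1] by (metis mult_1 V.cmul_one)
  then have "X 1 = 0" by (metis add_cancel_right_right)
  then have X0: "map_poly (scale c) (X 1) = 0" for c by simp
  show ?thesis
    unfolding K.extendible_def additive_def
    by (auto simp: R X X0 O_cmul_add_left O_vec_add O_vec_add_right O.cmul_add O.cmul_cmul
        K.d_mult O_cmul_vec O.vec_smul K.d_scale additive.add[OF K.additive_d] cmul_scale_one
        mult.commute simp del: K.scale_scale)
qed

lemma extendible_lbr: "K.extendible (\<lambda>a g. O.cmul a (dpoly (pb f g)) + O.vec (pb f a) (d g))"
  by (rule extendible_bracket)
    (simp_all add: additive.add[OF additive_pb] dpoly_add pb_scale dpoly_scale leibniz_cmul dpoly_cmul)

lemma additive_lbr: "additive (lbr f)"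
  unfolding lbr_def by (rule K.additive_additive_ext[OF extendible_lbr])

lemma lbr_gen: "lbr f (smul a (d g)) = O.cmul a (dpoly (pb f g)) + O.vec (pb f a) (d g)"
  unfolding lbr_def by (rule K.additive_ext_gen[OF extendible_lbr])

lemma rbr_add_right: "rbr g (u + v) = rbr g u + rbr g v"
  by (simp add: rbr_def additive.add[OF additive_lbr] O.reflect_add)

lemma reflect_vec_pb: "O.reflect (O.vec (pb g c) u) = - O.cotwist [:u:] (pb c g)"
  by (subst (2) skew) (simp add: O.cotwist_reflect[symmetric] additive.minus[OF O.additive_cotwist])

text \<open>Skew-symmetry of the Poisson bracket absorbs the reflection. In the resulting formula
  \<open>g\<close> occurs only as the right argument of \<open>pb\<close>, so its product rule
  becomes accessible.\<close>

lemma rbr_gen: "rbr g (smul c (d f)) = O.twist [:c:] (dpoly (pb f g)) + O.cotwist [:d f:] (pb c g)"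
proof -
  have "dpoly (pb f g) = - O.reflect (dpoly (pb g f))"
    by (subst skew) (simp add: dpoly_reflect map_poly_uminus[OF K.additive_d])
  then show ?thesis
    by (simp add: rbr_def lbr_gen O.reflect_add reflect_vec_pb O.twist_reflect O.twist_minus)
qed

lemma rbr_add: "rbr (g + h) u = rbr g u + rbr h u"
  by (induction u rule: K.kaehler_induct)
    (simp_all add: rbr_add_right rbr_gen additive.add[OF additive_pb] dpoly_add O.twist_add O.cotwist_add)

lemma rbr_scale: "rbr (scale c g) u = O.cmul (scale c 1) (rbr g u)"
proof (induction u rule: K.kaehler_induct)
  case (gen a f)
  have "O.cotwist U (map_poly (scale c) A) = O.cmul (scale c 1) (O.cotwist U A)" for U A
    using O.cotwist_smult[of U "scale c 1" A] by (simp add: smult_conv_map_poly mult_scale_one)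
  then show ?case
    by (simp add: rbr_gen pb_scale dpoly_scale O.twist_cmul O.cmul_add)
qed (simp add: rbr_add_right O.cmul_add)

text \<open>The anchor terms come from \<open>d\<close> differentiating the factors that the Leibniz
  rule leaves in front of the Poisson brackets.\<close>

lemma rbr_mult: "rbr (g * h) u =
  O.cmul g (rbr h u) + O.cmul h (rbr g u) + (O.vec (theta u g) (d h) + O.vec (theta u h) (d g))"
proof (induction u rule: K.kaehler_induct)
  case (gen c f)
  show ?case
    by (simp add: rbr_gen leibniz dpoly_add O.twist_add O.twist_cmul O.twist_vec theta_gen O.cotwist_add
      O.cotwist_smult O.cmul_add smult_conv_map_poly dpoly_cmul)
      (simp add: smult_conv_map_poly[symmetric] O.cotwist_smult)
qed (simp add: rbr_add_right O.cmul_add theta_add_left O_vec_add)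

lemma extendible_br: "K.extendible (\<lambda>a g. O.cmul a (rbr g u) + O.vec (theta u a) (d g))"
  by (rule extendible_bracket) (simp_all add: rbr_add rbr_scale rbr_mult theta_add theta_scale theta_mult)

lemma br_gen: "br u (smul a (d g)) = O.cmul a (rbr g u) + O.vec (theta u a) (d g)"
  unfolding br_def by (rule K.additive_ext_gen[OF extendible_br])

lemma additive_br: "additive (br u)"
  unfolding br_def by (rule K.additive_additive_ext[OF extendible_br])

lemmas br_add = additive.add[OF additive_br]

lemma br_add_left: "br (u + v) w = br u w + br v w"
  by (induction w rule: K.kaehler_induct)
    (simp_all add: br_add br_gen rbr_add_right theta_add_left O.cmul_add O_vec_add)

lemma additive_br_left: "additive (\<lambda>u. br u w)"
  by (simp add: additive_def br_add_left)

text \<open>On two generators the bracket has three terms. Reflection carries the term with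
  \<open>dpoly\<close> to its counterpart and interchanges the other two, so skew-symmetry of
  \<open>pb\<close> suffices.\<close>

lemma br_skew: "br v u = - O.reflect (br u v)"
proof (induction u rule: K.kaehler_induct)
  case (gen c f)
  show ?case
  proof (induction v rule: K.kaehler_induct)
    case (gen e g)
    have 1: "O.reflect (O.cmul a (O.twist [:b:] (dpoly (pb f' g'))))
        = - O.cmul b (O.twist [:a:] (dpoly (pb g' f')))" for a b f' g'
    proof -
      have "dpoly (pb g' f') = - O.reflect (dpoly (pb f' g'))"
        by (subst skew) (simp add: dpoly_reflect map_poly_uminus[OF K.additive_d])
      then show ?thesis
        by (simp add: O.twist_reflect[symmetric] O.reflect_twist O.twist_cmul O.twist_minus O.cmul_minus)
    qed
    have 2: "O.reflect (O.cmul a (O.cotwist [:u:] (pb b h))) = - O.vec (V.twist [:a:] (pb h b)) u" for a b h u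
      by (subst skew) (simp add: O.cotwist_reflect additive.minus[OF O.additive_cotwist]
        O.cmul_minus O.reflect_minus O.twist_reflect[symmetric] O.reflect_reflect O.twist_vec)
    have 3: "O.reflect (O.vec (V.twist [:a:] (pb h b)) u) = - O.cmul a (O.cotwist [:u:] (pb b h))" for a b h u
      using arg_cong[OF 2[of a u b h], of O.reflect]
      by (simp add: O.reflect_reflect O.reflect_minus)
    show ?case
      by (simp add: br_gen rbr_gen theta_gen O.cmul_add O.reflect_add 1 2 3)
  qed (simp add: br_add br_add_left O.reflect_add)
qed (simp add: br_add br_add_left O.reflect_add)

lemma br_d_d: "br (d f) (d g) = dpoly (pb f g)"
proof -
  have "pb 1 g = 0" using theta_one[of "d g"] by (subst skew) (simp add: theta_d additive.zero[OF V.additive_reflect])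
  then show ?thesis
    using br_gen[of "d f" 1 g] rbr_gen[of g 1 f] by (simp add: theta_one O.twist_one O.cotwist_zero O.cmul_one)
qed

section \<open>Rule (i) for functions and sesquilinearity\<close>

lemma br_smul: "br u (smul f v) = O.cmul f (br u v) + O.vec (theta u f) v"
proof (induction v rule: K.kaehler_induct)
  case (add v w)
  show ?case
    unfolding K.scale_right_distrib[of f] br_add add.IH O.cmul_add O_vec_add_right by (simp only: add_ac)
next
  case (gen a g)
  show ?case
    unfolding O.vec_smul O_cmul_vec
    by (simp add: br_gen O.cmul_add O.cmul_cmul theta_mult O_vec_add O_cmul_vec)
qed

lemma lbr_der: "lbr (der f) u = - pCons 0 (lbr f u)"
  by (induction u rule: K.kaehler_induct)
    (simp_all add: additive.add[OF additive_lbr] lbr_gen sesquilinear_left map_poly_uminus[OF K.additive_d]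
      O.cmul_minus additive.minus[OF O.additive_vec] map_poly_pCons additive.zero[OF K.additive_d])

lemma rbr_der: "rbr (der g) u = var_plus dK (rbr g u)"
  by (simp add: rbr_def lbr_der O.reflect_minus O.reflect_pCons additive.minus[OF O.additive_Lam]
      del: minus_pCons)

lemma br_dK: "br u (dK v) = var_plus dK (br u v)"
  by (induction v rule: K.kaehler_induct)
    (simp_all add: additive.add[OF additive_dK] br_add O.Lam_add dK_gen br_gen rbr_der theta_der
      O.vec_var_plus dK_d O.cmul_var_plus)

lemma br_dK_left: "br (dK u) v = - pCons 0 (br u v)"
  by (subst (1 2) br_skew) (simp add: br_dK poly_reflect_var_plus[OF additive_dK])

subsection \<open>The action of differential operators and the rules (i) and (i')\<close>

definition act :: "'a poly \<Rightarrow> 'o \<Rightarrow> 'o" where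
  "act a u = poly_sum (\<lambda>i c. smul c ((dK ^^ i) u)) a"

lemma additive_act_left: "additive (\<lambda>a. act a u)"
  unfolding act_def by (intro additive_poly_sum O.additive_smul_left)

lemma additive_act: "additive (act a)"
  using additive_funpow[OF additive_dK]
  by (simp add: act_def poly_sum_def additive_def K.scale_right_distrib sum.distrib)

lemma act_pCons: "act (pCons c a) u = smul c u + act a (dK u)"
  unfolding act_def
  by (subst poly_sum_pCons) (simp_all add: funpow_swap1)

lemma act_0: "act 0 u = 0"
  by (rule additive.zero[OF additive_act_left])

lemma act_const: "act [:c:] = smul c"
  by (rule ext) (simp add: act_pCons act_0)

lemma act_x: "act [:0, 1:] = dK"
  by (rule ext) (simp add: act_pCons act_0)

lemma act_smult: "act (smult c b) u = smul c (act b u)"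
  by (induction b arbitrary: u) (simp_all add: act_0 act_pCons K.scale_right_distrib)

lemma act_var_plus: "act (var_plus der b) u = dK (act b u)"
  by (induction b arbitrary: u)
    (simp_all add: act_0 act_pCons additive.zero[OF additive_dK] var_plus_pCons additive.zero[OF additive_der]
      additive.add[OF additive_act_left] additive.add[OF additive_dK] dK_smul,
     simp add: var_plus_def act_0)

lemma act_dop_mult: "act (dop_mult der a b) u = act a (act b u)"
proof -
  have "act (poly_sum (\<lambda>i c. smult c ((var_plus der ^^ i) b)) a) u = act a (act b u)"
  proof (induction a arbitrary: b)
    case (pCons c a)
    have "poly_sum (\<lambda>i c. smult c ((var_plus der ^^ i) b)) (pCons c a)
      = smult c b + poly_sum (\<lambda>i c. smult c ((var_plus der ^^ i) (var_plus der b))) a"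
      by (subst poly_sum_pCons) (simp_all add: funpow_swap1)
    then show ?case
      by (simp add: pCons.IH additive.add[OF additive_act_left] act_smult act_pCons act_var_plus)
  qed (simp add: poly_sum_def act_0)
  then show ?thesis by (simp add: dop_mult_def poly_sum_def)
qed

lemma left_dop_module_act: "left_dop_module der act"
  unfolding left_dop_module_def
  by (auto simp: additive.add[OF additive_act] additive.add[OF additive_act_left] act_dop_mult one_pCons act_const)

lemma kaehler_action_act: "kaehler_action der smul d act"
  by (simp add: kaehler_action_def left_dop_module_act act_const act_x dK_gen)

text \<open>The action of functions and of \<partial> is prescribed, and every operator is built
  from these by adding a function to a product with \<partial> on the right.\<close>

lemma kaehler_action_unique:
  assumes "kaehler_action der smul d act'"
  shows "act' = act"
proof (intro ext)
  have add: "\<And>a. additive (act' a)" "\<And>u. additive (\<lambda>a. act' a u)"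
    and mult: "\<And>a b u. act' (dop_mult der a b) u = act' a (act' b u)"
    and const: "\<And>f u. act' [:f:] u = smul f u"
    and gen: "\<And>f g. act' [:0, 1:] (smul f (d g)) = dK (smul f (d g))"
    using assms by (simp_all add: kaehler_action_def left_dop_module_def additive_def dK_gen)
  have x: "act' [:0, 1:] u = dK u" for u
    by (rule K.additive_eq_on_gen[OF add(1) additive_dK gen])
  \<comment> \<open>Since 1 has derivative 0, left multiplication by \<partial> only raises the
    exponent of a monomial with coefficient 1. Hence a(\<partial>)\<partial> has the shifted symbol
    \<open>pCons 0 a\<close>.\<close>
  have Lam: "var_plus der (monom 1 n) = monom 1 (Suc n)" for n
    by (simp add: var_plus_def map_poly_monom additive.zero[OF additive_der] der_one monom_Suc)
  have "(var_plus der ^^ n) [:0, 1:] = monom 1 (Suc n)" for n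
    by (induction n) (simp add: monom_Suc monom_0, simp only: funpow.simps o_apply Lam)
  then have "dop_mult der a [:0, 1:] = pCons 0 a" for a
    unfolding dop_mult_def
    by (subst (3) poly_as_sum_of_monoms[of a, symmetric])
      (simp add: smult_monom monom_Suc additive.sum[OF additive_pCons_0])
  then have shift: "act' (pCons 0 a) u = act' a (dK u)" for a u
    using mult[of a "[:0, 1:]" u] by (simp add: x)
  fix a u
  show "act' a u = act a u"
  proof (induction a arbitrary: u)
    case (pCons c a)
    then show ?case
      using additive_pCons[OF add(2)[of u], of c a] by (simp add: const shift act_pCons)
  qed (simp add: act_0 additive.zero[OF add(2)])
qed

lemma act_sum: "act a u = (\<Sum>i\<le>degree a. smul (coeff a i) ((dK ^^ i) u))"
  by (simp add: act_def poly_sum_def)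

lemma twist_cder_act: "cder_act der a \<phi> b = V.twist (V.reflect a) (\<phi> b)"
proof -
  have "smult x P = V.vec P x" for x P
    by (rule poly_eqI) (simp add: coeff_map_poly mult.commute)
  then show ?thesis
    by (simp add: cder_act_def adj_symbol_def V.twist_def poly_sum_def)
qed

lemma theta_act: "theta (act a u) b = cder_act der a (theta u) b"
proof -
  have "theta ((dK ^^ i) u) b = ((\<lambda>P. - pCons 0 P) ^^ i) (theta u b)" for i
    by (induction i) (simp_all add: theta_dK del: minus_pCons)
  then show ?thesis
    unfolding twist_cder_act V.twist_adj_symbol act_sum
    by (simp add: additive.sum[OF additive_theta] theta_smul)
qed

lemma is_anchor_theta: "is_anchor scale der act theta"
  by (simp add: is_anchor_def theta_CDer theta_add_left theta_act)

lemma kaehler_anchor_theta: "kaehler_anchor scale der pb d act theta"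
  by (simp add: kaehler_anchor_def is_anchor_theta theta_d)

lemma kaehler_anchor_unique:
  assumes "kaehler_anchor scale der pb d act \<theta>'"
  shows "\<theta>' = theta"
proof (intro ext)
  fix u h
  have add: "additive (\<lambda>u. \<theta>' u h)"
    and gen: "\<theta>' (act a (d f)) h = cder_act der a (\<theta>' (d f)) h"
    and d: "\<theta>' (d f) h = theta (d f) h" for a f
    using assms by (simp_all add: kaehler_anchor_def is_anchor_def additive_def theta_d)
  show "\<theta>' u h = theta u h"
  proof (rule K.additive_eq_on_gen[OF add additive_theta])
    fix a f
    show "\<theta>' (smul a (d f)) h = theta (smul a (d f)) h"
      using gen[of "[:a:]" f] theta_act[of "[:a:]" "d f" h] d by (simp add: act_const cder_act_def)
  qed
qed

lemma right_rule_br: "right_rule act theta br"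
  unfolding right_rule_def
proof (intro allI)
  fix u v a
  have "br u ((dK ^^ i) v) = (var_plus dK ^^ i) (br u v)" for i
    by (induction i) (simp_all add: br_dK)
  then show "br u (act a v) =
       (\<Sum>i\<le>degree a. const_times_poly act (coeff a i) ((var_plus (act [:0, 1:]) ^^ i) (br u v)))
     + (\<Sum>i\<le>degree a. poly_times_vec act (theta u (coeff a i)) ((act [:0, 1:] ^^ i) v))"
    by (simp add: act_x act_const act_sum additive.sum[OF additive_br] br_smul sum.distrib)
qed

lemma br_smul_left:
  "br (smul c u) v = O.twist [:c:] (br u v) - O.cotwist [:u:] (V.reflect (theta v c))"
  by (subst (1 2) br_skew) (simp add: br_smul O.reflect_add O.twist_minus O.twist_reflect O.cotwist_reflect)

lemma left_rule_br: "left_rule der act theta br"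
  unfolding left_rule_def
proof (intro allI)
  fix u v a
  \<comment> \<open>Each \<partial> on the left argument contributes -\<lambda>; twisting by the
    coefficients of \<open>a\<close> then assembles the adjoint symbol.\<close>
  have i: "br ((dK ^^ i) u) v = ((\<lambda>P. - pCons 0 P) ^^ i) (br u v)" for i
    by (induction i) (simp_all add: br_dK_left del: minus_pCons)
  have "br (act a u) v = O.twist (V.reflect a) (br u v)
      - (\<Sum>i\<le>degree a. O.cotwist [:(dK ^^ i) u:] (V.reflect (theta v (coeff a i))))"
    unfolding O.twist_adj_symbol
    by (simp add: act_sum additive.sum[OF additive_br_left] br_smul_left i sum_subtractf)
  then show "br (act a u) v =
       (\<Sum>n\<le>degree (br u v).
          poly_times_vec act ((var_plus der ^^ n) (adj_symbol der a)) (coeff (br u v) n))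
     - (\<Sum>i\<le>degree a. \<Sum>n\<le>degree (cder_adj der (theta v) (coeff a i)).
          const_times_poly act (coeff (cder_adj der (theta v) (coeff a i)) n)
            ((var_plus (act [:0, 1:]) ^^ n) [:(act [:0, 1:] ^^ i) u:]))"
    by (simp add: act_x act_const O.twist_def O.cotwist_def poly_sum_def cder_adj_def adj_symbol_def)
qed

lemma br_scal: "br u (O.scal c v) = O.cmul (scale c 1) (br u v)"
  by (simp add: br_smul theta_scale theta_one)

lemma bilinear_br: "bilinear_bracket O.scal br"
proof -
  have "O.reflect (O.cmul (scale c 1) Q) = O.cmul (scale c 1) (O.reflect Q)" for c Q
    by (rule map_poly_reflect[symmetric]) (simp_all add: O.additive_smul additive_dK O.D_scal)
  then have "br (O.scal c u) v = O.cmul (scale c 1) (br u v)" for c u v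
    by (subst (1 2) br_skew) (simp add: br_scal O.cmul_minus)
  then show ?thesis
    using O.E.vector_space_axioms vector_space_map_poly[OF O.E.vector_space_axioms]
    by (simp add: bilinear_bracket_def linear_iff_additive additive_br additive_br_left br_scal)
qed

lemma kaehler_bracket_br: "kaehler_bracket scale der pb d act theta br"
  by (simp add: kaehler_bracket_def act_const bilinear_br br_d_d right_rule_br left_rule_br)

text \<open>Rule (i) determines the bracket of df with every element from the values on pairs of
  generators; then (i') determines it for every left argument.\<close>

lemma kaehler_bracket_unique:
  assumes "kaehler_bracket scale der pb d act theta br'"
  shows "br' = br"
proof (intro ext)
  have add: "\<And>u. additive (br' u)" "\<And>v. additive (\<lambda>u. br' u v)"
    and d: "\<And>f g. br' (d f) (d g) = br (d f) (d g)"
    and right: "right_rule act theta br'" and left: "left_rule der act theta br'"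
    using assms by (simp_all add: kaehler_bracket_def bilinear_bracket_def linear_iff_additive br_d_d)
  have "br' (d f) (smul e (d g)) = br (d f) (smul e (d g))" for f e g
    using right[unfolded right_rule_def, rule_format, of "d f" "[:e:]" "d g"]
      right_rule_br[unfolded right_rule_def, rule_format, of "d f" "[:e:]" "d g"] d
    by (simp add: act_const)
  then have d': "br' (d f) v = br (d f) v" for f v
    by (rule K.additive_eq_on_gen[OF add(1) additive_br])
  fix u v
  have "br' (smul c (d f)) v = br (smul c (d f)) v" for c f
    using left[unfolded left_rule_def, rule_format, of "[:c:]" "d f" v]
      left_rule_br[unfolded left_rule_def, rule_format, of "[:c:]" "d f" v] d'
    by (simp add: act_const)
  then show "br' u v = br u v"
    by (rule K.additive_eq_on_gen[OF add(2) additive_br_left])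
qed

end

subsection \<open>The Jacobi identity and the anchor identity at scalars\<close>

text \<open>Stated for a general bracket because it is read forwards for the Poisson bracket and
  backwards for the new one.\<close>

lemma jacobi_iff:
  fixes s :: "'k::field_char_0 \<Rightarrow> 'e::ab_group_add \<Rightarrow> 'e"
  assumes s: "vector_space s" and "bilinear_bracket s b"
  shows "map_poly (b u) (b v w)
        - (\<Sum>m\<le>degree (b u w). map_poly (\<lambda>e. monom e m) (b v (coeff (b u w) m)))
       = (\<Sum>k\<le>degree (b u v).
            subst_var lam_plus_mu (map_poly (\<lambda>e. monom e k) (b (coeff (b u v) k) w)))
    \<longleftrightarrow> (\<forall>c e. poly_at s c (b u (poly_at s e (b v w))) - poly_at s e (b v (poly_at s c (b u w)))
          = poly_at s (c + e) (b (poly_at s c (b u v)) w))"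
    (is "?L = ?R \<longleftrightarrow> _")
proof -
  interpret vector_space s by fact
  have lin: "Vector_Spaces.linear s (\<lambda>c. map_poly (s c)) (b u)" "Vector_Spaces.linear s (\<lambda>c. map_poly (s c)) (\<lambda>u. b u v)" for u v
    using assms(2) by (simp_all add: bilinear_bracket_def)
  have "?L = ?R \<longleftrightarrow> (\<forall>c e. poly2_at s c e ?L = poly2_at s c e ?R)"
  proof (intro iffI allI)
    fix c e
    assume "?L = ?R"
    then show "poly2_at s c e ?L = poly2_at s c e ?R" by (rule arg_cong)
  next
    assume eq: "\<forall>c e. poly2_at s c e ?L = poly2_at s c e ?R"
    show "?L = ?R" by (rule poly2_at_eqI[OF s]) (rule eq[rule_format])
  qed
  moreover have "poly2_at s c e ?L = poly_at s c (b u (poly_at s e (b v w))) - poly_at s e (b v (poly_at s c (b u w)))" for c e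
    by (simp add: poly2_at_diff poly2_at_map_poly[OF lin(1) s] poly2_at_coeff_sum[OF lin(1) s])
  moreover have "poly2_at s c e ?R = poly_at s (c + e) (b (poly_at s c (b u v)) w)" for c e
    using poly2_at_coeff_sum[OF lin(2) s, of c "c + e" "b u v" w]
    by (simp add: poly2_at_sum poly2_at_lam_plus_mu)
  ultimately show ?thesis by simp
qed

context poisson_kaehler
begin

definition br_at :: "'k \<Rightarrow> 'o \<Rightarrow> 'o \<Rightarrow> 'o" where "br_at c u v = O.eval c (br u v)"
definition theta_at :: "'k \<Rightarrow> 'o \<Rightarrow> 'a \<Rightarrow> 'a" where "theta_at c u a = V.eval c (theta u a)"
definition pb_at :: "'k \<Rightarrow> 'a \<Rightarrow> 'a \<Rightarrow> 'a" where "pb_at c f g = V.eval c (pb f g)"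

definition jacobi_at :: "'o \<Rightarrow> 'o \<Rightarrow> 'o \<Rightarrow> bool" where
  "jacobi_at u v w \<longleftrightarrow> (\<forall>c e. br_at c u (br_at e v w) - br_at e v (br_at c u w) = br_at (c + e) (br_at c u v) w)"

definition anchor_at :: "'o \<Rightarrow> 'o \<Rightarrow> bool" where
  "anchor_at u v \<longleftrightarrow> (\<forall>c e a. theta_at c u (theta_at e v a) - theta_at e v (theta_at c u a)
     = theta_at (c + e) (br_at c u v) a)"

lemma pb_jacobi_at: "pb_at c f (pb_at e g h) - pb_at e g (pb_at c f h) = pb_at (c + e) (pb_at c f g) h"
  using iffD1[OF jacobi_iff[OF vector_space_axioms bilinear] jacobi, of f g h]
  by (simp add: pb_at_def mult_scale_one)

section \<open>Linearity, Leibniz rules and sesquilinearity at scalars\<close>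

lemma linear_theta_at: "Vector_Spaces.linear scale scale (theta_at c u)"
  using linear_poly_at[OF linear_theta vector_space_axioms]
  by (simp add: theta_at_def[abs_def] mult_scale_one)

lemma linear_theta_at_left: "Vector_Spaces.linear O.scal scale (\<lambda>u. theta_at c u a)"
proof -
  have "Vector_Spaces.linear O.scal (\<lambda>c. map_poly (scale c)) (\<lambda>u. theta u a)"
    using O.E.vector_space_axioms vector_space_map_poly[OF vector_space_axioms]
    by (simp add: linear_iff_additive additive_theta theta_scal)
  from linear_poly_at[OF this vector_space_axioms] show ?thesis
    by (simp add: theta_at_def mult_scale_one)
qed

lemma linear_br_at: "Vector_Spaces.linear O.scal O.scal (br_at c u)"
  and linear_br_at_left: "Vector_Spaces.linear O.scal O.scal (\<lambda>u. br_at c u v)"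
proof -
  have lin: "Vector_Spaces.linear O.scal (\<lambda>c. O.cmul (scale c 1)) (br u)"
    "Vector_Spaces.linear O.scal (\<lambda>c. O.cmul (scale c 1)) (\<lambda>u. br u v)"
    using bilinear_br by (simp_all add: bilinear_bracket_def)
  show "Vector_Spaces.linear O.scal O.scal (br_at c u)"
    "Vector_Spaces.linear O.scal O.scal (\<lambda>u. br_at c u v)"
    unfolding br_at_def[abs_def] by (intro linear_poly_at lin O.E.vector_space_axioms)+
qed

lemma additive_theta_at: "additive (theta_at c u)"
  and additive_theta_at_left: "additive (\<lambda>u. theta_at c u a)"
  and additive_br_at: "additive (br_at c u)"
  and additive_br_at_left: "additive (\<lambda>u. br_at c u v)"
  using linear_theta_at linear_theta_at_left linear_br_at linear_br_at_left
  by (simp_all add: linear_iff_additive)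

lemma theta_at_der: "theta_at c u (der a) = scale c (theta_at c u a) + der (theta_at c u a)"
  by (simp add: theta_at_def theta_der V.eval_var_plus scale_conv_mult[of c "V.eval c (theta u a)"])

lemma theta_at_mult: "theta_at c u (a * b) = theta_at c u a * b + a * theta_at c u b"
  by (simp add: theta_at_def theta_mult V.E.poly_at_add V.eval_cmul mult.commute)

lemma br_at_smul: "br_at c u (smul f v) = smul f (br_at c u v) + smul (theta_at c u f) v"
  by (simp add: br_at_def theta_at_def br_smul O.E.poly_at_add O.eval_cmul O.eval_vec)

lemma br_at_dK: "br_at c u (dK v) = O.scal c (br_at c u v) + dK (br_at c u v)"
  by (simp add: br_at_def br_dK O.eval_var_plus)

lemma br_at_dK_left: "br_at c (dK u) v = - O.scal c (br_at c u v)"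
  by (simp add: br_at_def br_dK_left O.E.poly_at_minus O.E.poly_at_pCons del: minus_pCons)

lemma theta_at_dK: "theta_at c (dK u) a = - scale c (theta_at c u a)"
  by (simp add: theta_at_def theta_dK V.E.poly_at_minus V.E.poly_at_pCons
    scale_conv_mult[of c "V.eval c (theta u a)"] del: minus_pCons)

lemma br_at_d_d: "br_at c (d f) (d g) = d (pb_at c f g)"
  unfolding br_at_def br_d_d pb_at_def
  by (rule poly_at_map_poly)
    (simp add: linear_iff_additive O.E.vector_space_axioms V.E.vector_space_axioms K.additive_d
      K.d_scale[symmetric] scale_conv_mult[symmetric])

lemma theta_at_d: "theta_at c (d f) a = pb_at c f a"
  by (simp add: theta_at_def pb_at_def theta_d)

text \<open>In the left slot of an operation at c+e the derivation acts as -(c+e), so the reflection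
  of the point e is just the point c.\<close>

lemma br_at_skew_left:
  "br_at (c + e) (br_at e v u) w = - br_at (c + e) (br_at c u v) w"
  "theta_at (c + e) (br_at e v u) a = - theta_at (c + e) (br_at c u v) a"
proof -
  have *: "br_at e v u = - O.eval e (O.reflect (br u v))"
    by (subst br_at_def, subst br_skew) (simp add: O.E.poly_at_minus)
  show "br_at (c + e) (br_at e v u) w = - br_at (c + e) (br_at c u v) w"
    unfolding * additive.minus[OF additive_br_at_left]
    by (subst O.eval_reflect_eq[OF linear_br_at_left br_at_dK_left]) (simp add: br_at_def)
  show "theta_at (c + e) (br_at e v u) a = - theta_at (c + e) (br_at c u v) a"
    unfolding * additive.minus[OF additive_theta_at_left]
    by (subst O.eval_reflect_eq[OF linear_theta_at_left theta_at_dK]) (simp add: br_at_def)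
qed

section \<open>Exchanging arguments in the scalar identities\<close>

lemma anchor_at_swap: "anchor_at u v \<Longrightarrow> anchor_at v u"
  unfolding anchor_at_def
  by (metis br_at_skew_left(2) add.commute minus_diff_eq)

lemma jacobi_at_swap12: "jacobi_at u v w \<Longrightarrow> jacobi_at v u w"
  unfolding jacobi_at_def
  by (metis br_at_skew_left(1) add.commute minus_diff_eq)

lemma jacobi_at_swap23:
  assumes "jacobi_at u v w"
  shows "jacobi_at u w v"
  unfolding jacobi_at_def
proof (intro allI)
  fix c e
  have *: "br_at e v w = - O.eval e (O.reflect (br w v))" for e v w
    by (subst br_at_def, subst br_skew) (simp add: O.E.poly_at_minus)
  \<comment> \<open>With c fixed and r free, the hypothesis says that one polynomial is the
    translate by c of another, and reflection reverses the translation.\<close>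
  have "O.eval r (map_poly (br_at c u) (br v w) - br v (br_at c u w)) = O.eval (c + r) (br (br_at c u v) w)" for r
    using assms by (simp add: O.E.poly_at_diff poly_at_map_poly[OF linear_br_at] jacobi_at_def br_at_def)
  from O.eval_reflect_translate[OF this, of e]
  have "O.eval (c + e) (O.reflect (map_poly (br_at c u) (br v w)))
      = O.eval (c + e) (O.reflect (br v (br_at c u w))) + O.eval e (O.reflect (br (br_at c u v) w))"
    by (simp add: additive.diff[OF O.additive_reflect] O.E.poly_at_diff diff_eq_eq add.commute)
  \<comment> \<open>Passing through the bracket with \<open>u\<close> shifts \<partial> by c, which
    moves the reflected point from e to c+e.\<close>
  moreover have "br_at c u (br_at e w v) = - O.eval (c + e) (O.reflect (map_poly (br_at c u) (br v w)))"
    unfolding *[of e w v] additive.minus[OF additive_br_at]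
    by (subst O.eval_reflect_map_poly[OF linear_br_at]) (simp_all add: br_at_dK)
  ultimately show "br_at c u (br_at e w v) - br_at e w (br_at c u v) = br_at (c + e) (br_at c u w) v"
    by (simp add: *[of e w] *[of "c + e"])
qed

section \<open>Spreading the identities from generators\<close>

lemma anchor_at_add:
  assumes "anchor_at u v" "anchor_at u w"
  shows "anchor_at u (v + w)"
  using assms
  by (simp add: anchor_at_def additive.add[OF additive_theta_at_left] additive.add[OF additive_br_at]
    additive.add[OF additive_theta_at]) (simp add: algebra_simps)

lemma anchor_at_smul:
  assumes "anchor_at u v"
  shows "anchor_at u (smul f v)"
  unfolding anchor_at_def
proof (intro allI)
  fix c e a
  have at: "theta_at r (smul g w) a' = V.eval r (V.twist [:g:] (theta w a'))" for r g w a'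
    by (simp add: theta_at_def theta_smul)
  \<comment> \<open>The hypothesis is again read as a translation by c in r; twisting by
    \<open>f\<close> respects translations.\<close>
  have "V.eval r (map_poly (theta_at c u) (theta v a) - theta v (theta_at c u a))
      = V.eval (c + r) (theta (br_at c u v) a)" for r
    using assms poly_at_map_poly[OF linear_theta_at, of r c u "theta v a"]
    by (simp add: poly_at_diff anchor_at_def theta_at_def mult_scale_one)
  from V.eval_twist_translate[OF this, of e f]
  have "V.eval e (V.twist [:f:] (map_poly (theta_at c u) (theta v a)))
      - V.eval e (V.twist [:f:] (theta v (theta_at c u a)))
      = V.eval (c + e) (V.twist [:f:] (theta (br_at c u v) a))"
    by (simp add: V.twist_diff V.E.poly_at_diff)
  \<comment> \<open>The extra summand at c+e matches the anchor term in the bracket of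
    \<open>u\<close> with \<open>smul f v\<close>.\<close>
  moreover have "theta_at c u (V.eval e (V.twist [:f:] (theta v a))) =
      V.eval (c + e) (V.twist [:theta_at c u f:] (theta v a)) +
      V.eval e (V.twist [:f:] (map_poly (theta_at c u) (theta v a)))"
    by (rule derivation_eval_twist[OF linear_theta_at theta_at_der theta_at_mult])
  ultimately show "theta_at c u (theta_at e (smul f v) a) - theta_at e (smul f v) (theta_at c u a)
     = theta_at (c + e) (br_at c u (smul f v)) a"
    by (simp add: at br_at_smul additive.add[OF additive_theta_at_left])
qed

lemma anchor_at_d: "anchor_at (d f) (d g)"
  by (simp add: anchor_at_def br_at_d_d theta_at_d pb_jacobi_at)

lemma anchor_at: "anchor_at u v"
proof -
  have ext: "anchor_at u v" if "\<And>g. anchor_at u (d g)" for u v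
    by (induction v rule: K.kaehler_induct) (simp_all add: anchor_at_add anchor_at_smul that)
  then show ?thesis
    \<comment> \<open>Extend the right argument, swap, and extend the other one.\<close>
    using anchor_at_d anchor_at_swap by blast
qed

lemma jacobi_at_extend:
  assumes "\<And>h. jacobi_at u v (d h)"
  shows "jacobi_at u v w"
proof (induction w rule: K.kaehler_induct)
  case (add w w')
  then show ?case
    by (simp add: jacobi_at_def additive.add[OF additive_br_at]) (simp add: algebra_simps)
next
  case (gen f h)
  show ?case
    unfolding jacobi_at_def
  proof (intro allI)
    fix c e
    have 1: "br_at c u (br_at e v (d h)) - br_at e v (br_at c u (d h)) = br_at (c + e) (br_at c u v) (d h)"
      using assms by (simp add: jacobi_at_def)
    have 2: "theta_at c u (theta_at e v f) - theta_at e v (theta_at c u f) = theta_at (c + e) (br_at c u v) f"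
      using anchor_at by (simp add: anchor_at_def)
    show "br_at c u (br_at e v (smul f (d h))) - br_at e v (br_at c u (smul f (d h)))
        = br_at (c + e) (br_at c u v) (smul f (d h))"
      \<comment> \<open>The mixed terms, one anchor value times one bracket, cancel in pairs; the
        terms with two anchors are settled by the anchor identity.\<close>
      unfolding br_at_smul 1[symmetric] 2[symmetric] additive.add[OF additive_br_at]
      by (simp add: K.scale_right_diff_distrib K.scale_left_diff_distrib)
  qed
qed

lemma jacobi_at_d: "jacobi_at (d f) (d g) (d h)"
  by (simp add: jacobi_at_def br_at_d_d pb_jacobi_at[symmetric] additive.diff[OF K.additive_d])

text \<open>The two transpositions generate all permutations, so each slot can be moved to the right
  and extended there.\<close>

lemma jacobi_at: "jacobi_at u v w"
  using jacobi_at_extend jacobi_at_d jacobi_at_swap12 jacobi_at_swap23 by meson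

section \<open>Return from scalars to polynomial identities\<close>

lemma lie_conformal_algebra_br: "lie_conformal_algebra O.scal dK br"
proof (intro lie_conformal_algebra.intro lie_conformal_algebra_axioms.intro)
  show "vector_space O.scal" by (rule O.E.vector_space_axioms)
  show "Vector_Spaces.linear O.scal O.scal dK" by (rule O.linear_D)
  show "bilinear_bracket O.scal br" by (rule bilinear_br)
  show "br (dK u) v = - pCons 0 (br u v)" for u v by (rule br_dK_left)
  show "br u (dK v) = var_plus dK (br u v)" for u v by (rule br_dK)
  show "br v u = - O.reflect (br u v)" for u v by (rule br_skew)
  show "map_poly (br u) (br v w)
        - (\<Sum>m\<le>degree (br u w). map_poly (\<lambda>e. monom e m) (br v (coeff (br u w) m)))
       = (\<Sum>k\<le>degree (br u v).
            subst_var lam_plus_mu (map_poly (\<lambda>e. monom e k) (br (coeff (br u v) k) w)))" for u v w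
    unfolding jacobi_iff[OF O.E.vector_space_axioms bilinear_br]
    using jacobi_at[of u v w] by (simp add: jacobi_at_def br_at_def)
qed

lemma anchor_bracket_br:
  "(\<Sum>k\<le>degree (br u v). map_poly (\<lambda>e. monom e k) (theta (coeff (br u v) k) a))
     = subst_var mu_minus_lam (map_poly (theta u) (theta v a))
       - (\<Sum>m\<le>degree (theta u a).
            subst_var mu_minus_lam (map_poly (\<lambda>e. monom e m) (theta v (coeff (theta u a) m))))"
    (is "?L = ?R")
proof (rule poly2_at_eqI[OF vector_space_axioms])
  fix c e
  have lin: "Vector_Spaces.linear O.scal (\<lambda>c. map_poly (scale c)) (\<lambda>u. theta u a)"
    using O.E.vector_space_axioms vector_space_map_poly[OF vector_space_axioms]
    by (simp add: linear_iff_additive additive_theta theta_scal)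
  have "poly2_at scale c e ?L = theta_at e (br_at c u v) a"
    by (simp add: poly2_at_coeff_sum[OF lin vector_space_axioms] theta_at_def br_at_def mult_scale_one)
  \<comment> \<open>Taking e-c as the second scalar makes the anchor identity end at c+(e-c) = e, in
    agreement with \<mu>-\<lambda>.\<close>
  also have "\<dots> = theta_at c u (theta_at (e - c) v a) - theta_at (e - c) v (theta_at c u a)"
    using anchor_at[of u v] by (simp add: anchor_at_def)
  also have "\<dots> = poly2_at scale c e ?R"
    using poly2_at_coeff_sum[OF linear_theta vector_space_axioms, of c "e - c" v "theta u a"]
    by (simp add: poly2_at_diff poly2_at_sum poly2_at_mu_minus_lam theta_at_def mult_scale_one
      poly2_at_map_poly[OF linear_theta vector_space_axioms])
  finally show "poly2_at scale c e ?L = poly2_at scale c e ?R" .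
qed

lemma lie_conformal_algebroid_br: "lie_conformal_algebroid scale der act theta br"
  by (intro lie_conformal_algebroid.intro lie_conformal_algebroid_axioms.intro differential_algebra_axioms
      left_dop_module_act is_anchor_theta right_rule_br anchor_bracket_br)
    (simp add: act_const act_x lie_conformal_algebra_br)

end

theorem theorem4p6:
  fixes scale :: "'k::field_char_0 \<Rightarrow> 'v::comm_ring_1 \<Rightarrow> 'v"
    and der :: "'v \<Rightarrow> 'v"
    and pb :: "'v \<Rightarrow> 'v \<Rightarrow> 'v poly"
    and smul :: "'v \<Rightarrow> 'o::ab_group_add \<Rightarrow> 'o"
    and d :: "'v \<Rightarrow> 'o"
  assumes "poisson_vertex_algebra scale der pb"
    and "kaehler_differentials scale smul d"
  shows "\<exists>act \<theta> br.
      (\<forall>act'. kaehler_action der smul d act' \<longleftrightarrow> act' = act) \<and>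
      (\<forall>\<theta>'. kaehler_anchor scale der pb d act \<theta>' \<longleftrightarrow> \<theta>' = \<theta>) \<and>
      (\<forall>br'. kaehler_bracket scale der pb d act \<theta> br' \<longleftrightarrow> br' = br) \<and>
      lie_conformal_algebroid scale der act \<theta> br"
proof -
  interpret poisson_kaehler scale der pb smul d
    using assms by (rule poisson_kaehler.intro)
  show ?thesis
    by (metis kaehler_action_act kaehler_action_unique kaehler_anchor_theta kaehler_anchor_unique
      kaehler_bracket_br kaehler_bracket_unique lie_conformal_algebroid_br)
qed

end
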